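(* Let $p\in[1,2]$. Let $E$ be a Banach space which is reflexive or has separable dual, and suppose that $E^{**}$ has the approximation property. Let $F$ be a Banach space with separable dual. If $\psi\colon E\to F$ is a $p$-summing operator and $(\phi_n)_{n\in\mathbb{N}}$ is a sequence of bounded linear operators $\phi_n\colon F\to F$ converging strongly to $0$ (that is, $\|\phi_n y\|\to 0$ as $n\to\infty$ for every $y\in F$), then $$\pi_p(\phi_n\psi)\to 0 \qquad\text{as } n\to\infty.$$
   Context: A bounded linear operator $u\colon E\to F$ between Banach spaces is called $p$-summing if there is a constant $c$ such that $$\Big(\sum_{k=1}^n \|u(x_k)\|^p\Big)^{1/p}\le c\,\sup\Big\{\Big(\sum_{k=1}^n |x^*(x_k)|^p\Big)^{1/p} : x^*\in E^*,\ \|x^*\|\le 1\Big\}$$ for all $n\in\mathbb{N}$ and $x_1,\dots,x_n\in E$. The $p$-summing norm $\pi_p(u)$ is the smallest such constant $c$. A Banach space $Z$ has the approximation property if for every compact set $K\subseteq Z$ and every $\varepsilon>0$ there exists a finite rank bounded linear operator $u\colon Z\to Z$ such that $\|u(x)-x\|\le\varepsilon$ for all $x\in K$. *)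

theory Defs
  imports "HOL-Analysis.Analysis"
begin

text \<open>Banach spaces are types of class \<open>banach\<close>, so the scalars are real; the dual of \<open>'a\<close> is the
  type \<open>'a \<Rightarrow>\<^sub>L real\<close> with the operator norm.\<close>

definition weak_p_norm :: "real \<Rightarrow> nat \<Rightarrow> (nat \<Rightarrow> 'a::real_normed_vector) \<Rightarrow> real" where
  "weak_p_norm p n x =
     (SUP f\<in>{f :: 'a \<Rightarrow>\<^sub>L real. norm f \<le> 1}. (\<Sum>k<n. \<bar>blinfun_apply f (x k)\<bar> powr p) powr (1 / p))"

text \<open>The restriction \<open>0 \<le> c\<close> matters only when \<open>'a\<close> is the zero space, where every real \<open>c\<close>
  satisfies the inequalities and there would be no smallest constant.\<close>

definition summing_constants ::
    "real \<Rightarrow> ('a::real_normed_vector \<Rightarrow>\<^sub>L 'b::real_normed_vector) \<Rightarrow> real set" where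
  "summing_constants p u =
     {c. 0 \<le> c \<and>
        (\<forall>n x. (\<Sum>k<n. norm (u (x k)) powr p) powr (1 / p) \<le> c * weak_p_norm p n x)}"

definition p_summing ::
    "real \<Rightarrow> ('a::real_normed_vector \<Rightarrow>\<^sub>L 'b::real_normed_vector) \<Rightarrow> bool" where
  "p_summing p u \<longleftrightarrow> summing_constants p u \<noteq> {}"

text \<open>The infimum is the smallest constant if \<open>u\<close> is \<open>p\<close>-summing (\<open>pi_p_mem\<close>, \<open>pi_p_le\<close> below), and
  carries no information otherwise.\<close>

definition pi_p ::
    "real \<Rightarrow> ('a::real_normed_vector \<Rightarrow>\<^sub>L 'b::real_normed_vector) \<Rightarrow> real" where
  "pi_p p u = Inf (summing_constants p u)"

lift_definition bidual_embedding :: "'a::real_normed_vector \<Rightarrow> (('a \<Rightarrow>\<^sub>L real) \<Rightarrow>\<^sub>L real)"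
  is "\<lambda>x f. blinfun_apply f x"
  by (rule blinfun.bounded_linear_left)

definition reflexive_space :: "'a::real_normed_vector itself \<Rightarrow> bool" where
  "reflexive_space _ \<longleftrightarrow> surj (bidual_embedding :: 'a \<Rightarrow> _)"

definition finite_rank :: "('a::real_normed_vector \<Rightarrow>\<^sub>L 'b::real_normed_vector) \<Rightarrow> bool" where
  "finite_rank u \<longleftrightarrow> (\<exists>B. finite B \<and> range (blinfun_apply u) \<subseteq> span B)"

definition approximation_property :: "'a::real_normed_vector itself \<Rightarrow> bool" where
  "approximation_property _ \<longleftrightarrow>
     (\<forall>K :: 'a set. compact K \<longrightarrow>
        (\<forall>\<epsilon>>0. \<exists>u :: 'a \<Rightarrow>\<^sub>L 'a. finite_rank u \<and> (\<forall>x\<in>K. norm (u x - x) \<le> \<epsilon>)))"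

lemma pi_p_le: "c \<in> summing_constants p u \<Longrightarrow> pi_p p u \<le> c"
  unfolding pi_p_def by (rule cInf_lower) (auto simp: summing_constants_def bdd_below_def)

lemma weak_p_norm_bdd:
  fixes x :: "nat \<Rightarrow> 'a::real_normed_vector"
  assumes "1 \<le> p"
  shows "bdd_above ((\<lambda>f. (\<Sum>k<n. \<bar>blinfun_apply f (x k)\<bar> powr p) powr (1 / p)) `
           {f :: 'a \<Rightarrow>\<^sub>L real. norm f \<le> 1})"
proof (rule bdd_aboveI2)
  fix f :: "'a \<Rightarrow>\<^sub>L real" assume "f \<in> {f. norm f \<le> 1}"
  then have f: "norm f \<le> 1" by simp
  have "\<bar>f y\<bar> \<le> norm y" for y
    using norm_blinfun[of f y] mult_right_mono[OF f norm_ge_zero[of y]] by simp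
  then show "(\<Sum>k<n. \<bar>f (x k)\<bar> powr p) powr (1 / p) \<le> (\<Sum>k<n. norm (x k) powr p) powr (1 / p)"
    using assms by (intro powr_mono2 sum_mono sum_nonneg) auto
qed

lemma weak_p_norm_nonneg:
  fixes x :: "nat \<Rightarrow> 'a::real_normed_vector"
  assumes "1 \<le> p"
  shows "0 \<le> weak_p_norm p n x"
  unfolding weak_p_norm_def
  by (rule cSUP_upper2[OF weak_p_norm_bdd[OF assms], of 0]) auto

lemma pi_p_mem:
  assumes "1 \<le> p" and "p_summing p u"
  shows "pi_p p u \<in> summing_constants p u"
proof -
  let ?S = "summing_constants p u"
  have ne: "?S \<noteq> {}" using assms(2) by (simp add: p_summing_def)
  have "(\<Sum>k<n. norm (u (x k)) powr p) powr (1 / p) \<le> Inf ?S * weak_p_norm p n x" (is "?L \<le> _")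
    for n x
  proof (cases "weak_p_norm p n x = 0")
    case True
    obtain c where "?L \<le> c * weak_p_norm p n x"
      using ne by (auto simp: summing_constants_def)
    then show ?thesis using True by simp
  next
    case False
    then have w: "0 < weak_p_norm p n x"
      using weak_p_norm_nonneg[OF assms(1), of n x] by simp
    have "?L / weak_p_norm p n x \<le> Inf ?S"
      using w by (intro cInf_greatest[OF ne]) (auto simp: summing_constants_def divide_le_eq)
    then show ?thesis using w by (simp add: divide_le_eq)
  qed
  moreover have "0 \<le> Inf ?S"
    by (intro cInf_greatest[OF ne]) (simp add: summing_constants_def)
  ultimately show ?thesis by (simp add: pi_p_def summing_constants_def)
qed

text \<open>In particular \<open>pi_p\<close> is meaningful for every composite of a bounded operator with a
  \<open>p\<close>-summing one.\<close>

lemma p_summing_compose: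
  fixes u :: "'a::real_normed_vector \<Rightarrow>\<^sub>L 'b::real_normed_vector"
    and v :: "'b \<Rightarrow>\<^sub>L 'c::real_normed_vector"
  assumes "1 \<le> p" and "p_summing p u"
  shows "p_summing p (v o\<^sub>L u)"
proof -
  obtain c where c: "0 \<le> c"
    "\<And>n x. (\<Sum>k<n. norm (u (x k)) powr p) powr (1 / p) \<le> c * weak_p_norm p n x"
    using assms(2) by (auto simp: p_summing_def summing_constants_def)
  have "(\<Sum>k<n. norm ((v o\<^sub>L u) (x k)) powr p) powr (1 / p) \<le> (norm v * c) * weak_p_norm p n x"
    for n x
  proof -
    have "(\<Sum>k<n. norm ((v o\<^sub>L u) (x k)) powr p) powr (1 / p)
        \<le> (\<Sum>k<n. (norm v * norm (u (x k))) powr p) powr (1 / p)"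
      using assms(1) by (intro powr_mono2 sum_mono sum_nonneg) (auto simp: norm_blinfun)
    also have "\<dots> = (norm v powr p * (\<Sum>k<n. norm (u (x k)) powr p)) powr (1 / p)"
      by (simp add: powr_mult sum_distrib_left)
    also have "\<dots> = norm v * (\<Sum>k<n. norm (u (x k)) powr p) powr (1 / p)"
      using assms(1) by (simp add: powr_mult powr_powr sum_nonneg)
    also have "\<dots> \<le> norm v * (c * weak_p_norm p n x)"
      by (intro mult_left_mono c norm_ge_zero)
    finally show ?thesis by (simp add: mult.assoc)
  qed
  then show ?thesis
    using c(1) unfolding p_summing_def summing_constants_def by (auto intro!: exI[of _ "norm v * c"])
qed

end

theory Submission
  imports Defs "HOL-Library.Function_Algebras"
begin

text \<open>By Pietsch's theorem \<open>\<psi>\<close> is dominated by a positive functional \<open>L\<close> on the continuous functions on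
  the weak-* compact dual ball. If the dual is separable, or if the space is reflexive, the support of
  \<open>L\<close> is norm separable, and \<open>L\<close> is concentrated, up to a summable error, on a null sequence \<open>w\<close> of
  functionals. A trace argument deduces from the approximation property of the bidual that some finite
  rank operator \<open>u\<close> on the space satisfies \<open>\<parallel>w n - w n \<circ> u\<parallel> \<le> \<epsilon>\<close> for all \<open>n\<close>, and then
  \<open>\<pi>\<^sub>p(\<psi> - \<psi> \<circ> u)\<close> is of order \<open>\<epsilon>\<close>. Since the \<open>\<phi>\<^sub>n\<close> are uniformly bounded, this reduces the claim to the
  finite rank operator \<open>\<psi> \<circ> u\<close>, for which it follows from the strong convergence.\<close>

section \<open>Hahn-Banach theorems\<close>

text \<open>The finite rank operator must act on the space itself, so that it can be composed with
  \<open>\<psi>\<close>; operators on the dual that approximate the \<open>w n\<close> need not be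
  adjoints. Duality turns the search into a trace problem for the tensors of \<open>w n\<close> with
  functionals \<open>g n\<close> on the dual. The compact set to be approximated thus lies in the
  bidual, which is where the approximation property enters.

  A second obstacle is that \<open>L\<close> integrates continuous functions only. Distances on the
  dual ball are merely semicontinuous for the weak-* topology. They are replaced by directed
  families of continuous functions, and Dini's theorem does the work of the convergence theorems of
  integration.

  A null sequence is enough although the support need not be norm compact: its functionals are sums
  of increments of a countable dense sequence. In mean these increments shrink as fast as desired
  once the finite sets of centres are large, which absorbs the factor \<open>2 ^ j\<close> lost by
  damping them.\<close>

definition sublinear_on :: "'a::real_vector set \<Rightarrow> ('a \<Rightarrow> real) \<Rightarrow> bool" where
  "sublinear_on V q \<longleftrightarrow> (\<forall>x\<in>V. \<forall>y\<in>V. q (x + y) \<le> q x + q y) \<and>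
     (\<forall>x\<in>V. \<forall>t>0. q (t *\<^sub>R x) \<le> t * q x)"

lemma sublinear_onI:
  assumes "\<And>x y. x \<in> V \<Longrightarrow> y \<in> V \<Longrightarrow> q (x + y) \<le> q x + q y"
    and "\<And>x t. x \<in> V \<Longrightarrow> 0 < t \<Longrightarrow> q (t *\<^sub>R x) \<le> t * q x"
  shows "sublinear_on V q"
  using assms by (auto simp: sublinear_on_def)

lemma sublinear_on_add: "sublinear_on V q \<Longrightarrow> x \<in> V \<Longrightarrow> y \<in> V \<Longrightarrow> q (x + y) \<le> q x + q y"
  by (simp add: sublinear_on_def)

text \<open>Applying the inequality with the factor \<open>1 / t\<close> reverses it, so the
  definition only has to ask for \<open>\<le>\<close>. The restriction to \<open>V\<close> serves
  the continuous functions inside the type of all functions.\<close>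

lemma sublinear_on_scale:
  assumes "sublinear_on V q" "subspace V" "x \<in> V" "0 < t"
  shows "q (t *\<^sub>R x) = t * q x"
proof (rule antisym)
  show "q (t *\<^sub>R x) \<le> t * q x" using assms by (simp add: sublinear_on_def)
  have "t *\<^sub>R x \<in> V" using assms by (simp add: subspace_scale)
  moreover have "0 < 1 / t" using assms(4) by simp
  ultimately have "q ((1/t) *\<^sub>R (t *\<^sub>R x)) \<le> (1/t) * q (t *\<^sub>R x)"
    using assms(1) unfolding sublinear_on_def by blast
  then show "t * q x \<le> q (t *\<^sub>R x)" using assms(4) by (simp add: field_simps)
qed

lemma sublinear_on_0:
  assumes "sublinear_on V q" "subspace V" shows "q 0 = 0"
  using sublinear_on_scale[OF assms subspace_0[OF assms(2)], of 2] by simp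

lemma sublinear_on_minus:
  assumes "sublinear_on V q" "subspace V" "x \<in> V" shows "- q (- x) \<le> q x"
  using sublinear_on_add[OF assms(1,3) subspace_neg[OF assms(2,3)]] sublinear_on_0[OF assms(1,2)]
  by simp

text \<open>For sublinear \<open>q\<close> this is the largest sublinear functional below
  \<open>q\<close> with value at most \<open>- q a\<close> at \<open>- a\<close>. Every linear
  functional below it therefore takes the value \<open>q a\<close> at \<open>a\<close>.\<close>

definition directional_minorant :: "('a::real_vector \<Rightarrow> real) \<Rightarrow> 'a \<Rightarrow> 'a \<Rightarrow> real" where
  "directional_minorant q a x = (INF t\<in>{0..}. q (x + t *\<^sub>R a) - t * q a)"

lemma directional_minorant_le:
  assumes q: "sublinear_on V q" and V: "subspace V" and a: "a \<in> V" and x: "x \<in> V" and t: "0 \<le> t"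
  shows "directional_minorant q a x \<le> q (x + t *\<^sub>R a) - t * q a"
  unfolding directional_minorant_def
proof (rule cINF_lower)
  \<comment> \<open>A lower bound gives the infimum its meaning; it comes from
    \<open>s *\<^sub>R a = (x + s *\<^sub>R a) + (- x)\<close>.\<close>
  have "- q (- x) \<le> q (x + s *\<^sub>R a) - s * q a" if "0 \<le> s" for s
  proof (cases "s = 0")
    case True
    then show ?thesis using sublinear_on_minus[OF q V x] by simp
  next
    case False
    have sa: "s *\<^sub>R a \<in> V" using a V by (simp add: subspace_scale)
    have "q ((x + s *\<^sub>R a) + (- x)) \<le> q (x + s *\<^sub>R a) + q (- x)"
      using q V a x sa by (intro sublinear_on_add) (auto intro: subspace_add subspace_neg)
    then show ?thesis using sublinear_on_scale[OF q V a, of s] False that by simp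
  qed
  then show "bdd_below ((\<lambda>t. q (x + t *\<^sub>R a) - t * q a) ` {0..})"
    by (intro bdd_belowI2[where m = "- q (- x)"]) auto
qed (use t in auto)

lemma directional_minorant_sublinear:
  assumes q: "sublinear_on V q" and V: "subspace V" and a: "a \<in> V"
  shows "sublinear_on V (directional_minorant q a)"
proof (rule sublinear_onI)
  note le = directional_minorant_le[OF q V a]
  have g: "c \<le> directional_minorant q a x" if "\<And>t. 0 \<le> t \<Longrightarrow> c \<le> q (x + t *\<^sub>R a) - t * q a" for c x
    unfolding directional_minorant_def by (rule cINF_greatest) (use that in auto)
  fix x y assume x: "x \<in> V" and y: "y \<in> V"
  \<comment> \<open>The parameters \<open>t\<close> and \<open>s\<close> of the two summands combine
    to \<open>t + s\<close>.\<close>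
  have "directional_minorant q a (x + y) - (q (x + t *\<^sub>R a) - t * q a) \<le> directional_minorant q a y"
    if t: "0 \<le> t" for t
  proof (rule g)
    fix s :: real assume s: "0 \<le> s"
    have "directional_minorant q a (x + y) \<le> q ((x + y) + (t + s) *\<^sub>R a) - (t + s) * q a"
      using x y V s t by (intro le) (auto intro: subspace_add)
    also have "(x + y) + (t + s) *\<^sub>R a = (x + t *\<^sub>R a) + (y + s *\<^sub>R a)"
      by (simp add: algebra_simps)
    also have "q \<dots> \<le> q (x + t *\<^sub>R a) + q (y + s *\<^sub>R a)"
      using x y a V q by (intro sublinear_on_add) (auto intro: subspace_add subspace_scale)
    finally show "directional_minorant q a (x + y) - (q (x + t *\<^sub>R a) - t * q a)
        \<le> q (y + s *\<^sub>R a) - s * q a"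
      by (simp add: algebra_simps)
  qed
  then have "directional_minorant q a (x + y) - directional_minorant q a y \<le> directional_minorant q a x"
    by (intro g) (simp add: algebra_simps)
  then show "directional_minorant q a (x + y) \<le> directional_minorant q a x + directional_minorant q a y"
    by simp
next
  note le = directional_minorant_le[OF q V a]
  fix x and t :: real assume x: "x \<in> V" and t: "0 < t"
  have "directional_minorant q a (t *\<^sub>R x) / t \<le> directional_minorant q a x"
    unfolding directional_minorant_def[of q a x]
  proof (rule cINF_greatest)
    fix s :: real assume s: "s \<in> {0..}"
    have "directional_minorant q a (t *\<^sub>R x) \<le> q (t *\<^sub>R x + (t * s) *\<^sub>R a) - (t * s) * q a"
      using x V s t by (intro le) (auto intro: subspace_scale)
    also have "t *\<^sub>R x + (t * s) *\<^sub>R a = t *\<^sub>R (x + s *\<^sub>R a)" by (simp add: algebra_simps)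
    also have "q \<dots> = t * q (x + s *\<^sub>R a)"
      using x a V t by (intro sublinear_on_scale[OF q V]) (auto intro: subspace_add subspace_scale)
    finally show "directional_minorant q a (t *\<^sub>R x) / t \<le> q (x + s *\<^sub>R a) - s * q a"
      using t by (simp add: field_simps)
  qed auto
  then show "directional_minorant q a (t *\<^sub>R x) \<le> t * directional_minorant q a x"
    using t by (simp add: field_simps)
qed

text \<open>Zorn's lemma for the reversed order. The infimum of a chain stays subadditive because of
  two members the smaller one bounds both summands; the bound \<open>- p (- x)\<close> keeps it
  finite.\<close>

lemma ex_minimal_sublinear:
  assumes p: "sublinear_on V p" and V: "subspace V"
  obtains m where "sublinear_on V m" "\<And>x. x \<in> V \<Longrightarrow> m x \<le> p x"
    "\<And>q x. sublinear_on V q \<Longrightarrow> (\<And>x. x \<in> V \<Longrightarrow> q x \<le> m x) \<Longrightarrow> x \<in> V \<Longrightarrow> q x = m x"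
proof -
  \<comment> \<open>The fixed value 0 off \<open>V\<close> reduces comparison of functions to the
    points of \<open>V\<close>.\<close>
  define A where "A = {q. sublinear_on V q \<and> (\<forall>x\<in>V. q x \<le> p x) \<and> (\<forall>x. x \<notin> V \<longrightarrow> q x = 0)}"
  define P :: "('a \<Rightarrow> real) \<Rightarrow> ('a \<Rightarrow> real) \<Rightarrow> bool" where "P q r \<longleftrightarrow> (\<forall>x. r x \<le> q x)" for q r
  define cut :: "('a \<Rightarrow> real) \<Rightarrow> 'a \<Rightarrow> real" where "cut q x = (if x \<in> V then q x else 0)" for q x
  have cut: "sublinear_on V (cut q)" if "sublinear_on V q" for q
    using that V by (auto simp: sublinear_on_def cut_def subspace_add subspace_scale)
  have "\<exists>m\<in>A. \<forall>a\<in>A. P m a \<longrightarrow> a = m"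
  proof (rule predicate_Zorn)
    show "partial_order_on A (relation_of P A)"
      by (rule partial_order_on_relation_ofI) (auto simp: P_def fun_eq_iff intro: order_trans antisym)
    fix C assume C: "C \<in> Chains (relation_of P A)"
    then have CA: "C \<subseteq> A" and ch: "\<And>q r. q \<in> C \<Longrightarrow> r \<in> C \<Longrightarrow> P q r \<or> P r q"
      unfolding Chains_def relation_of_def by auto
    show "\<exists>u\<in>A. \<forall>q\<in>C. P q u"
    proof (cases "C = {}")
      case True
      have "cut p \<in> A" using cut[OF p] by (auto simp: A_def cut_def)
      then show ?thesis using True by auto
    next
      case False
      define u where "u = cut (\<lambda>x. INF q\<in>C. q x)"
      have bd: "bdd_below ((\<lambda>q. q x) ` C)" if "x \<in> V" for x
      proof (rule bdd_belowI2)
        fix q assume "q \<in> C"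
        then have q: "sublinear_on V q" "q (- x) \<le> p (- x)"
          using CA that V by (auto simp: A_def subspace_neg)
        show "- p (- x) \<le> q x" using sublinear_on_minus[OF q(1) V that] q(2) by simp
      qed
      have ule: "u x \<le> q x" if "x \<in> V" "q \<in> C" for x q
        using bd[OF that(1)] that by (auto simp: u_def cut_def intro: cINF_lower)
      have ug: "c \<le> u x" if "x \<in> V" "\<And>q. q \<in> C \<Longrightarrow> c \<le> q x" for c x
        using that False by (auto simp: u_def cut_def intro: cINF_greatest)
      have "sublinear_on V u"
      proof (rule sublinear_onI)
        fix x y assume x: "x \<in> V" and y: "y \<in> V"
        have split: "u (x + y) \<le> q x + r y" if q: "q \<in> C" and r: "r \<in> C" for q r
        proof -
          obtain z where z: "z \<in> C" "z x \<le> q x" "z y \<le> r y"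
            using ch[OF q r] q r by (auto simp: P_def)
          have "u (x + y) \<le> z (x + y)" using ule[of "x + y" z] x y z V by (simp add: subspace_add)
          also have "\<dots> \<le> z x + z y" using CA z x y by (auto simp: A_def intro: sublinear_on_add)
          finally show ?thesis using z by simp
        qed
        have "u (x + y) - u y \<le> u x"
        proof (rule ug[OF x])
          fix q assume q: "q \<in> C"
          have "u (x + y) - q x \<le> u y"
          proof (rule ug[OF y])
            fix r assume "r \<in> C"
            then show "u (x + y) - q x \<le> r y" using split[OF q, of r] by linarith
          qed
          then show "u (x + y) - u y \<le> q x" by simp
        qed
        then show "u (x + y) \<le> u x + u y" by simp
      next
        fix x and t :: real assume x: "x \<in> V" and t: "0 < t"
        have "u (t *\<^sub>R x) / t \<le> u x"
        proof (rule ug[OF x])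
          fix q assume q: "q \<in> C"
          have "u (t *\<^sub>R x) \<le> q (t *\<^sub>R x)" using ule q x V by (simp add: subspace_scale)
          also have "\<dots> = t * q x" using q CA x t V by (auto simp: A_def intro: sublinear_on_scale)
          finally show "u (t *\<^sub>R x) / t \<le> q x" using t by (simp add: field_simps)
        qed
        then show "u (t *\<^sub>R x) \<le> t * u x" using t by (simp add: field_simps)
      qed
      moreover have "u x \<le> p x" if "x \<in> V" for x
        using False CA ule[OF that] that by (fastforce simp: A_def)
      ultimately have "u \<in> A" by (auto simp: A_def) (simp add: u_def cut_def)
      moreover have "P q u" if "q \<in> C" for q
      proof -
        have "u x \<le> q x" for x
        proof (cases "x \<in> V")
          case False
          then have "q x = 0" using that CA by (auto simp: A_def)
          then show ?thesis using False by (simp add: u_def cut_def)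
        qed (simp add: ule that)
        then show ?thesis by (simp add: P_def)
      qed
      ultimately show ?thesis by blast
    qed
  qed
  then obtain m where m: "m \<in> A" "\<And>a. a \<in> A \<Longrightarrow> P m a \<Longrightarrow> a = m" by blast
  show thesis
  proof
    show "sublinear_on V m" "\<And>x. x \<in> V \<Longrightarrow> m x \<le> p x" using m by (auto simp: A_def)
    fix q x assume q: "sublinear_on V q" "\<And>x. x \<in> V \<Longrightarrow> q x \<le> m x" and x: "x \<in> V"
    have "cut q \<in> A" using cut[OF q(1)] q(2) m(1) by (force simp: A_def cut_def)
    moreover have "P m (cut q)" using q(2) m(1) by (auto simp: A_def P_def cut_def)
    ultimately show "q x = m x" using m(2)[of "cut q"] x by (metis cut_def)
  qed
qed

text \<open>A minimal sublinear functional coincides with all its directional minorants, which makes it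
  superadditive, hence linear.\<close>

theorem hahn_banach_sublinear:
  assumes p: "sublinear_on V p" and V: "subspace V"
  obtains f :: "'a::real_vector \<Rightarrow> real" where "\<And>x. x \<in> V \<Longrightarrow> f x \<le> p x"
    "\<And>x y. x \<in> V \<Longrightarrow> y \<in> V \<Longrightarrow> f (x + y) = f x + f y"
    "\<And>c x. x \<in> V \<Longrightarrow> f (c *\<^sub>R x) = c * f x"
proof -
  obtain m where m: "sublinear_on V m" "\<And>x. x \<in> V \<Longrightarrow> m x \<le> p x"
    and min: "\<And>q x. sublinear_on V q \<Longrightarrow> (\<And>x. x \<in> V \<Longrightarrow> q x \<le> m x) \<Longrightarrow> x \<in> V \<Longrightarrow> q x = m x"
    using ex_minimal_sublinear[OF p V] by blast
  have add: "m (x + a) = m x + m a" if x: "x \<in> V" and a: "a \<in> V" for x a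
  proof (rule antisym)
    show "m (x + a) \<le> m x + m a" using m x a by (simp add: sublinear_on_add)
    have "directional_minorant m a y \<le> m y" if "y \<in> V" for y
      using directional_minorant_le[OF m(1) V a that, of 0] by simp
    then have "directional_minorant m a x = m x"
      by (intro min directional_minorant_sublinear m V a x)
    then show "m x + m a \<le> m (x + a)"
      using directional_minorant_le[OF m(1) V a x, of 1] by simp
  qed
  have neg: "m (- x) = - m x" if "x \<in> V" for x
    using add[OF that subspace_neg[OF V that]] sublinear_on_0[OF m(1) V] by simp
  have "m (c *\<^sub>R x) = c * m x" if x: "x \<in> V" for c x
  proof (cases c "0::real" rule: linorder_cases)
    case less
    have "m (- ((- c) *\<^sub>R x)) = - m ((- c) *\<^sub>R x)"
      using x V by (intro neg) (rule subspace_scale)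
    then show ?thesis using sublinear_on_scale[OF m(1) V x, of "- c"] less by simp
  next
    case equal
    then show ?thesis using sublinear_on_0[OF m(1) V] by simp
  next
    case greater
    then show ?thesis using sublinear_on_scale[OF m(1) V x] by simp
  qed
  with m add show thesis using that by blast
qed

text \<open>The distance to \<open>R\<close> is sublinear, at most the norm, and zero on
  \<open>R\<close>. Passing to its directional minorant at \<open>a\<close> forces the largest
  possible value there.\<close>

theorem hahn_banach_infdist:
  fixes R :: "'a::real_normed_vector set"
  assumes R: "subspace R"
  obtains f :: "'a \<Rightarrow>\<^sub>L real" where "norm f \<le> 1" "\<And>x. x \<in> R \<Longrightarrow> f x = 0" "f a = infdist a R"
proof -
  define q where "q x = infdist x R" for x
  have ne: "R \<noteq> {}" and R0: "0 \<in> R" using subspace_0[OF R] by auto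
  have qg: "c \<le> q x" if "\<And>r. r \<in> R \<Longrightarrow> c \<le> norm (x - r)" for c x
    using ne that by (auto simp: q_def infdist_def dist_norm intro: cINF_greatest)
  have ql: "q x \<le> norm (x - r)" if "r \<in> R" for x r
    using infdist_le[OF that, of x] by (simp add: q_def dist_norm)
  have q: "sublinear_on UNIV q"
  proof (rule sublinear_onI)
    fix x y :: 'a
    have "q (x + y) \<le> norm (x - r) + norm (y - s)" if "r \<in> R" "s \<in> R" for r s
    proof -
      have "q (x + y) \<le> norm ((x + y) - (r + s))" by (intro ql subspace_add R that)
      also have "\<dots> \<le> norm (x - r) + norm (y - s)" by (metis add_diff_add norm_triangle_ineq)
      finally show ?thesis .
    qed
    then have "q (x + y) - norm (x - r) \<le> q y" if "r \<in> R" for r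
      using that by (intro qg) (simp add: algebra_simps)
    then have "q (x + y) - q y \<le> q x" by (intro qg) (simp add: algebra_simps)
    then show "q (x + y) \<le> q x + q y" by simp
  next
    fix x :: 'a and t :: real assume t: "0 < t"
    have "q (t *\<^sub>R x) / t \<le> q x"
    proof (rule qg)
      fix r assume "r \<in> R"
      then have "q (t *\<^sub>R x) \<le> norm (t *\<^sub>R x - t *\<^sub>R r)" by (intro ql subspace_scale R)
      also have "\<dots> = t * norm (x - r)" using t by (simp flip: scaleR_diff_right)
      finally show "q (t *\<^sub>R x) / t \<le> norm (x - r)" using t by (simp add: field_simps)
    qed
    then show "q (t *\<^sub>R x) \<le> t * q x" using t by (simp add: field_simps)
  qed
  let ?p = "directional_minorant q a"
  have p: "sublinear_on UNIV ?p" by (rule directional_minorant_sublinear[OF q]) auto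
  have ple: "?p x \<le> q (x + t *\<^sub>R a) - t * q a" if "0 \<le> t" for x t
    using directional_minorant_le[OF q] that by auto
  obtain f where f: "\<And>x. f x \<le> ?p x" "\<And>x y. f (x + y) = f x + f y" "\<And>c x. f (c *\<^sub>R x) = c * f x"
    using hahn_banach_sublinear[OF p] by auto
  have fq: "f x \<le> q x" for x using f(1)[of x] ple[of 0 x] by simp
  have fneg: "f (- x) = - f x" for x using f(3)[of "-1" x] by simp
  have qn: "q x \<le> norm x" for x using ql[OF R0, of x] by simp
  have fn: "\<bar>f x\<bar> \<le> norm x" for x
    using fq[of x] fq[of "- x"] qn[of x] qn[of "- x"] by (simp add: fneg)
  have bl: "bounded_linear f"
    by (rule bounded_linear_intro[where K = 1]) (use f fn in auto)
  have q0: "q x = 0" if "x \<in> R" for x using that by (simp add: q_def infdist_zero)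
  show thesis
  proof
    show "norm (Blinfun f) \<le> 1"
      by (rule norm_blinfun_bound) (use fn bl in \<open>auto simp: bounded_linear_Blinfun_apply\<close>)
    show "Blinfun f x = 0" if "x \<in> R" for x
      using fq[of x] fq[of "- x"] q0[OF that] q0[OF subspace_neg[OF R that]]
      by (simp add: bounded_linear_Blinfun_apply[OF bl] fneg)
    have "- f a \<le> - q a"
      using f(1)[of "- a"] ple[of 1 "- a"] q0[OF R0] by (simp add: fneg)
    then show "Blinfun f a = infdist a R"
      using fq[of a] by (simp add: bounded_linear_Blinfun_apply[OF bl] q_def)
  qed
qed

corollary ex_norming_functional:
  fixes a :: "'a::real_normed_vector"
  obtains f :: "'a \<Rightarrow>\<^sub>L real" where "norm f \<le> 1" "f a = norm a"
  using hahn_banach_infdist[of "{0::'a}" a] by (auto simp: infdist_def dist_norm subspace_0)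

section \<open>Finite rank operators and the approximation property of the bidual\<close>

definition rank_one :: "('a::real_normed_vector \<Rightarrow>\<^sub>L real) \<Rightarrow> 'b::real_normed_vector \<Rightarrow> 'a \<Rightarrow>\<^sub>L 'b" where
  "rank_one f y = blinfun_scaleR_left y o\<^sub>L f"

lemma rank_one_apply [simp]: "rank_one f y x = f x *\<^sub>R y"
  by (simp add: rank_one_def)

definition rank_ones :: "('a::real_normed_vector \<Rightarrow>\<^sub>L 'b::real_normed_vector) set" where
  "rank_ones = range (case_prod rank_one)"

text \<open>Subtracting a rank one operator moves the range into the span of the images under
  \<open>P\<close> of the remaining generators. The induction runs over cardinalities because
  \<open>P\<close> changes the generators.\<close>

lemma finite_rank_in_span_rank_ones:
  fixes v :: "'a::real_normed_vector \<Rightarrow>\<^sub>L 'b::real_normed_vector"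
  assumes "finite_rank v"
  shows "v \<in> span rank_ones"
proof -
  have "v \<in> span rank_ones" if "finite B" "card B = n" "range (blinfun_apply v) \<subseteq> span B"
    for B n and v :: "'a \<Rightarrow>\<^sub>L 'b"
    using that
  proof (induction n arbitrary: B v rule: less_induct)
    case (less n)
    show ?case
    proof (cases "B = {}")
      case True
      then have "v = 0" using less.prems by (intro blinfun_eqI) auto
      then show ?thesis by (simp add: span_0)
    next
      case False
      then obtain b B' where B: "B = insert b B'" "b \<notin> B'" by (metis ex_in_conv mk_disjoint_insert)
      obtain f :: "'b \<Rightarrow>\<^sub>L real" where f: "f b = norm b" using ex_norming_functional by blast
      \<comment> \<open>\<open>P\<close> kills \<open>b\<close> because \<open>f b = norm b\<close>;
        for \<open>b = 0\<close> the quotient \<open>1 / norm b\<close> is 0 and \<open>P\<close> is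
        the identity.\<close>
      define P where "P = id_blinfun - rank_one ((1 / norm b) *\<^sub>R f) b"
      have P: "P y = y - (f y / norm b) *\<^sub>R b" for y
        by (simp add: P_def blinfun.diff_left blinfun.scaleR_left)
      have Pb: "P b = 0" by (simp add: P f)
      have "range (P o\<^sub>L v) \<subseteq> P ` span B" using less.prems by auto
      also have "\<dots> = span (P ` B)"
        by (rule linear_span_image[symmetric]) (rule bounded_linear.linear[OF blinfun.bounded_linear_right])
      also have "\<dots> = span (P ` B')" by (simp add: B Pb span_insert_0)
      finally have "range (P o\<^sub>L v) \<subseteq> span (P ` B')" .
      moreover have "card (P ` B') < n"
        using less.prems B card_image_le[of B' P] by (auto simp: card_insert_if)
      moreover have "finite (P ` B')" using less.prems B by auto
      ultimately have "P o\<^sub>L v \<in> span rank_ones" using less.IH by blast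
      moreover have "v = (P o\<^sub>L v) + rank_one (((1 / norm b) *\<^sub>R f) o\<^sub>L v) b"
        by (rule blinfun_eqI) (simp only: P blinfun.add_left blinfun.scaleR_left rank_one_apply
            blinfun_apply_blinfun_compose real_scaleR_def times_divide_eq_left mult_1 diff_add_cancel)
      moreover have "rank_one (((1 / norm b) *\<^sub>R f) o\<^sub>L v) b \<in> span rank_ones"
        by (intro span_base) (auto simp: rank_ones_def)
      ultimately show ?thesis by (metis span_add)
    qed
  qed
  then show ?thesis using assms by (auto simp: finite_rank_def)
qed

lemma norm_scaleR_sgn: "norm x *\<^sub>R sgn x = x" for x :: "'a::real_normed_vector"
  by (cases "x = 0") (simp_all add: sgn_div_norm)

text \<open>A one-sided bound suffices as the unit ball is symmetric. The contrapositive supplies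
  vectors that almost attain the norm.\<close>

lemma blinfun_norm_le_functional:
  fixes g :: "'a::real_normed_vector \<Rightarrow>\<^sub>L real"
  assumes "\<And>x. norm x \<le> 1 \<Longrightarrow> g x \<le> c"
  shows "norm g \<le> c"
proof (rule norm_blinfun_bound)
  show "0 \<le> c" using assms[of 0] by simp
  fix x
  have "g (sgn x) \<le> c" "g (- sgn x) \<le> c" by (auto intro!: assms simp: norm_sgn)
  then have "\<bar>g (sgn x)\<bar> \<le> c" by (simp add: blinfun.minus_right)
  then have "\<bar>g (sgn x)\<bar> * norm x \<le> c * norm x" by (simp add: mult_right_mono)
  also have "\<bar>g (sgn x)\<bar> * norm x = \<bar>g (norm x *\<^sub>R sgn x)\<bar>"
    by (simp add: blinfun.scaleR_right abs_mult)
  also have "norm x *\<^sub>R sgn x = x" by (rule norm_scaleR_sgn)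
  finally show "norm (g x) \<le> c * norm x" by simp
qed

section \<open>The dual of the null sequences\<close>

lemma bcontfun_nat: "bounded (range f) \<Longrightarrow> f \<in> bcontfun" for f :: "nat \<Rightarrow> 'a::metric_space"
  by (simp add: bcontfun_def)

definition single_seq :: "nat \<Rightarrow> 'a::real_normed_vector \<Rightarrow> nat \<Rightarrow>\<^sub>C 'a" where
  "single_seq n x = Bcontfun (\<lambda>i. if i = n then x else 0)"

lemma single_seq_apply [simp]: "single_seq n x i = (if i = n then x else 0)"
proof -
  have "range (\<lambda>i. if i = n then x else 0) \<subseteq> {x, 0}" by auto
  then have "(\<lambda>i. if i = n then x else 0) \<in> bcontfun"
    by (intro bcontfun_nat) (meson bounded_subset finite.emptyI finite.insertI finite_imp_bounded)
  then show ?thesis by (simp add: single_seq_def Bcontfun_inverse)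
qed

lemma bcontfun_sum_apply: "(\<Sum>i\<in>A. f i) x = (\<Sum>i\<in>A. f i x)"
  for f :: "'i \<Rightarrow> ('a::topological_space \<Rightarrow>\<^sub>C 'b::real_normed_vector)"
  by (induction A rule: infinite_finite_induct) auto

text \<open>The duality between vector-valued \<open>c_0\<close> and \<open>l_1\<close>. Bounded
  sequences form the ambient normed space, as every sequence on the discrete \<open>nat\<close> is
  continuous; the formula is for null sequences, whose truncations converge in norm.\<close>

lemma null_sequence_functional:
  fixes \<Phi> :: "(nat \<Rightarrow>\<^sub>C 'a::real_normed_vector) \<Rightarrow>\<^sub>L real"
  shows "\<exists>g :: nat \<Rightarrow> 'a \<Rightarrow>\<^sub>L real. summable (\<lambda>n. norm (g n)) \<and>
    (\<forall>z. apply_bcontfun z \<longlonglongrightarrow> 0 \<longrightarrow> (\<lambda>n. blinfun_apply (g n) (z n)) sums \<Phi> z)"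
proof (intro exI conjI allI impI)
  define g where "g n = Blinfun (\<lambda>x. \<Phi> (single_seq n x))" for n
  have nz: "norm (single_seq n x) \<le> norm x" for n and x :: 'a
    by (rule norm_bound) auto
  have "bounded_linear (\<lambda>x. \<Phi> (single_seq n x))" for n
  proof (rule bounded_linear_intro[where K = "norm \<Phi>"])
    show "\<Phi> (single_seq n (x + y)) = \<Phi> (single_seq n x) + \<Phi> (single_seq n y)" for x y
      by (subst blinfun.add_right[symmetric], rule arg_cong[where f = "blinfun_apply \<Phi>"])
        (auto intro!: bcontfun_eqI)
    show "\<Phi> (single_seq n (c *\<^sub>R x)) = c *\<^sub>R \<Phi> (single_seq n x)" for c x
      by (subst blinfun.scaleR_right[symmetric], rule arg_cong[where f = "blinfun_apply \<Phi>"])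
        (auto intro!: bcontfun_eqI)
    show "norm (\<Phi> (single_seq n x)) \<le> norm x * norm \<Phi>" for x
      using norm_blinfun[of \<Phi> "single_seq n x"] mult_left_mono[OF nz norm_ge_zero, of \<Phi> n x]
      by (simp add: mult.commute)
  qed
  then have g: "g n x = \<Phi> (single_seq n x)" for n x
    by (simp add: g_def bounded_linear_Blinfun_apply)
  have part: "(\<Sum>n<N. g n (x n)) = \<Phi> (\<Sum>n<N. single_seq n (x n))" for N x
    by (simp add: g blinfun.sum_right)
  have papp: "(\<Sum>n<N. single_seq n (x n)) i = (if i < N then x i else 0)" for N i and x :: "nat \<Rightarrow> 'a"
    by (simp add: bcontfun_sum_apply)
  have "(\<Sum>n<N. norm (g n)) \<le> norm \<Phi>" for N
  proof (rule field_le_epsilon)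
    fix e :: real assume e: "0 < e"
    define \<eta> where "\<eta> = e / (real N + 1)"
    have \<eta>: "0 < \<eta>" "real N * \<eta> \<le> e" using e by (auto simp: \<eta>_def field_simps)
    \<comment> \<open>Almost norming vectors, collected in one finite sequence of sup norm at most
      1, turn the sum of norms into a single value of \<open>\<Phi>\<close>; the total error is
      \<open>N * \<eta> \<le> e\<close>.\<close>
    have "\<exists>x. norm x \<le> 1 \<and> norm (g n) - \<eta> < g n x" for n
      using blinfun_norm_le_functional[of "g n" "norm (g n) - \<eta>"] \<eta> by force
    then obtain x where x: "\<And>n. norm (x n) \<le> 1" "\<And>n. norm (g n) - \<eta> < g n (x n)" by metis
    have "(\<Sum>n<N. norm (g n)) - real N * \<eta> = (\<Sum>n<N. norm (g n) - \<eta>)" by (simp add: sum_subtractf)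
    also have "\<dots> \<le> (\<Sum>n<N. g n (x n))" by (intro sum_mono less_imp_le x)
    also have "\<dots> \<le> norm \<Phi> * norm (\<Sum>n<N. single_seq n (x n))"
      unfolding part using norm_blinfun[of \<Phi>] by (metis abs_le_D1 real_norm_def)
    also have "\<dots> \<le> norm \<Phi> * 1"
      by (intro mult_left_mono norm_bound norm_ge_zero) (auto simp: papp x)
    finally show "(\<Sum>n<N. norm (g n)) \<le> norm \<Phi> + e" using \<eta> by simp
  qed
  then show "summable (\<lambda>n. norm (g n))" by (intro summableI_nonneg_bounded) auto
  fix z :: "nat \<Rightarrow>\<^sub>C 'a" assume z: "(\<lambda>n. z n) \<longlonglongrightarrow> 0"
  have "(\<lambda>N. \<Sum>n<N. single_seq n (z n)) \<longlonglongrightarrow> z"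
  proof (rule LIMSEQ_I)
    fix r :: real assume r: "0 < r"
    then obtain M where M: "\<And>n. n \<ge> M \<Longrightarrow> norm (z n) < r / 2"
      using LIMSEQ_D[OF z, of "r / 2"] by auto
    have "norm ((\<Sum>n<N. single_seq n (z n)) - z) \<le> r / 2" if "N \<ge> M" for N
      using M that r by (intro norm_bound) (auto simp: papp less_imp_le)
    then show "\<exists>M. \<forall>N\<ge>M. norm ((\<Sum>n<N. single_seq n (z n)) - z) < r"
      using r by (intro exI[of _ M]) fastforce
  qed
  then show "(\<lambda>n. g n (z n)) sums \<Phi> z"
    unfolding sums_def part by (intro tendsto_intros)
qed

text \<open>The series is the trace of \<open>v\<close> against the tensor of the \<open>w n\<close>
  and \<open>g n\<close>, and assumption \<open>0\<close> says that this tensor vanishes when tested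
  on points and functionals. Absolute convergence lifts this first to an identity in the dual
  (\<open>T\<close>), then to one in the bidual (\<open>G\<close>); a functional \<open>h\<close>
  applied to \<open>G\<close> is the trace for a rank one \<open>v\<close>.\<close>

lemma trace_vanishes:
  fixes w :: "nat \<Rightarrow> 'a::real_normed_vector \<Rightarrow>\<^sub>L real" and g :: "nat \<Rightarrow> ('a \<Rightarrow>\<^sub>L real) \<Rightarrow>\<^sub>L real"
    and v :: "(('a \<Rightarrow>\<^sub>L real) \<Rightarrow>\<^sub>L real) \<Rightarrow>\<^sub>L (('a \<Rightarrow>\<^sub>L real) \<Rightarrow>\<^sub>L real)"
  assumes w: "Bseq w" and g: "summable (\<lambda>n. norm (g n))"
    and 0: "\<And>x f. (\<lambda>n. w n x * g n f) sums 0"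
    and v: "v \<in> span rank_ones"
  shows "(\<lambda>n. (v (g n)) (w n)) sums 0"
proof -
  obtain B where B: "\<And>n. norm (w n) \<le> B" using w by (auto simp: Bseq_def)
  have B0: "0 \<le> B" using norm_ge_zero B order_trans by blast
  have T: "(\<lambda>n. g n f *\<^sub>R w n) sums 0" for f
  proof -
    have "summable (\<lambda>n. g n f *\<^sub>R w n)"
    proof (rule summable_comparison_test')
      show "summable (\<lambda>n. norm (g n) * (norm f * B))" using g by (rule summable_mult2)
      show "norm (g n f *\<^sub>R w n) \<le> norm (g n) * (norm f * B)" for n
        using mult_mono[OF norm_blinfun[of "g n" f] B[of n]] B0 by (simp add: mult.assoc)
    qed
    then have S: "(\<lambda>n. g n f *\<^sub>R w n) sums (\<Sum>n. g n f *\<^sub>R w n)" by (rule summable_sums)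
    have "(\<Sum>n. g n f *\<^sub>R w n) x = 0" for x
    proof -
      have "(\<lambda>n. (g n f *\<^sub>R w n) x) sums (\<Sum>n. g n f *\<^sub>R w n) x"
        by (rule bounded_linear.sums[OF blinfun.bounded_linear_left S])
      moreover have "(\<lambda>n. (g n f *\<^sub>R w n) x) sums 0"
        using 0[of x f] by (simp add: blinfun.scaleR_left mult.commute)
      ultimately show ?thesis by (rule sums_unique2)
    qed
    then have "(\<Sum>n. g n f *\<^sub>R w n) = 0" by (intro blinfun_eqI) simp
    with S show ?thesis by simp
  qed
  have G: "(\<lambda>n. \<gamma> (w n) *\<^sub>R g n) sums 0" for \<gamma> :: "('a \<Rightarrow>\<^sub>L real) \<Rightarrow>\<^sub>L real"
  proof -
    have "summable (\<lambda>n. \<gamma> (w n) *\<^sub>R g n)"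
    proof (rule summable_comparison_test')
      show "summable (\<lambda>n. (norm \<gamma> * B) * norm (g n))" using g by (rule summable_mult)
      show "norm (\<gamma> (w n) *\<^sub>R g n) \<le> (norm \<gamma> * B) * norm (g n)" for n
        using order_trans[OF norm_blinfun[of \<gamma> "w n"] mult_left_mono[OF B[of n] norm_ge_zero]]
        by (simp add: mult_right_mono)
    qed
    then have S: "(\<lambda>n. \<gamma> (w n) *\<^sub>R g n) sums (\<Sum>n. \<gamma> (w n) *\<^sub>R g n)" by (rule summable_sums)
    have "(\<Sum>n. \<gamma> (w n) *\<^sub>R g n) f = 0" for f
    proof -
      have "(\<lambda>n. (\<gamma> (w n) *\<^sub>R g n) f) sums (\<Sum>n. \<gamma> (w n) *\<^sub>R g n) f"
        by (rule bounded_linear.sums[OF blinfun.bounded_linear_left S])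
      moreover have "(\<lambda>n. \<gamma> (g n f *\<^sub>R w n)) sums \<gamma> 0"
        by (rule bounded_linear.sums[OF blinfun.bounded_linear_right T])
      ultimately show ?thesis
        by (auto simp: blinfun.scaleR_left blinfun.scaleR_right mult.commute dest: sums_unique2)
    qed
    then have "(\<Sum>n. \<gamma> (w n) *\<^sub>R g n) = 0" by (intro blinfun_eqI) simp
    with S show ?thesis by simp
  qed
  show ?thesis
    using v
  proof (induction rule: span_induct)
    case base
    have "(\<lambda>n. ((a + b) (g n)) (w n)) sums 0"
      if "(\<lambda>n. (a (g n)) (w n)) sums 0" "(\<lambda>n. (b (g n)) (w n)) sums 0"
      for a b :: "(('a \<Rightarrow>\<^sub>L real) \<Rightarrow>\<^sub>L real) \<Rightarrow>\<^sub>L (('a \<Rightarrow>\<^sub>L real) \<Rightarrow>\<^sub>L real)"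
      using sums_add[OF that] by (simp add: blinfun.add_left)
    moreover have "(\<lambda>n. ((c *\<^sub>R a) (g n)) (w n)) sums 0" if "(\<lambda>n. (a (g n)) (w n)) sums 0"
      for c and a :: "(('a \<Rightarrow>\<^sub>L real) \<Rightarrow>\<^sub>L real) \<Rightarrow>\<^sub>L (('a \<Rightarrow>\<^sub>L real) \<Rightarrow>\<^sub>L real)"
      using sums_mult[OF that, of c] by (simp add: blinfun.scaleR_left)
    ultimately show ?case by (intro subspaceI) simp_all
  next
    case (step v)
    then obtain h \<gamma> where v: "v = rank_one h \<gamma>" by (auto simp: rank_ones_def)
    have "(\<lambda>n. h (\<gamma> (w n) *\<^sub>R g n)) sums h 0"
      by (rule bounded_linear.sums[OF blinfun.bounded_linear_right G])
    then show ?case by (simp add: v blinfun.scaleR_right blinfun.scaleR_left mult.commute)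
  qed
qed

text \<open>If no finite sum \<open>u\<close> of rank one operators worked, a functional would separate the sequence
  \<open>w\<close> from all sequences \<open>w n \<circ> u\<close>; the functional is a summable sequence in the bidual, and
  after approximating the latter by finite rank operators the trace argument gives a contradiction.\<close>

lemma bidual_ap_approximates_adjointly:
  fixes w :: "nat \<Rightarrow> 'a::real_normed_vector \<Rightarrow>\<^sub>L real"
  assumes ap: "approximation_property TYPE(('a \<Rightarrow>\<^sub>L real) \<Rightarrow>\<^sub>L real)"
    and w: "w \<longlonglongrightarrow> 0" and \<epsilon>: "0 < \<epsilon>"
  obtains u :: "'a \<Rightarrow>\<^sub>L 'a" where "u \<in> span rank_ones" "\<And>n. norm (w n - (w n o\<^sub>L u)) \<le> \<epsilon>"
proof -
  have wB: "Bseq w" using w convergentI convergent_imp_Bseq by blast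
  then obtain B where B: "\<And>n. norm (w n) \<le> B" by (auto simp: Bseq_def)
  have B0: "0 \<le> B" using norm_ge_zero B order_trans by blast
  define z where "z u = Bcontfun (\<lambda>n. w n o\<^sub>L u)" for u :: "'a \<Rightarrow>\<^sub>L 'a"
  have z: "z u n = w n o\<^sub>L u" for u n
  proof -
    have "norm (w n o\<^sub>L u) \<le> B * norm u" for n
      by (rule order_trans[OF norm_blinfun_compose]) (simp add: B mult_right_mono)
    then have "bounded (range (\<lambda>n. w n o\<^sub>L u))" by (auto simp: bounded_iff)
    then show ?thesis by (simp add: z_def Bcontfun_inverse bcontfun_nat)
  qed
  have z0: "(\<lambda>n. z u n) \<longlonglongrightarrow> 0" for u
    unfolding z using bounded_bilinear.tendsto[OF bounded_bilinear_blinfun_compose w tendsto_const, of u]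
    by (simp add: blinfun_compose_zero)
  have "linear z"
    by (rule linearI; rule bcontfun_eqI)
      (simp_all add: z bounded_bilinear.add_right[OF bounded_bilinear_blinfun_compose]
        bounded_bilinear.scaleR_right[OF bounded_bilinear_blinfun_compose])
  then have R: "subspace (z ` span rank_ones)" by (intro linear_subspace_image) auto
  obtain \<Phi> :: "(nat \<Rightarrow>\<^sub>C ('a \<Rightarrow>\<^sub>L real)) \<Rightarrow>\<^sub>L real"
    where "norm \<Phi> \<le> 1" and \<Phi>: "\<And>x. x \<in> z ` span rank_ones \<Longrightarrow> \<Phi> x = 0"
      "\<Phi> (z id_blinfun) = infdist (z id_blinfun) (z ` span rank_ones)"
    using hahn_banach_infdist[OF R, of "z id_blinfun"] by metis
  obtain g :: "nat \<Rightarrow> ('a \<Rightarrow>\<^sub>L real) \<Rightarrow>\<^sub>L real" where g: "summable (\<lambda>n. norm (g n))"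
    "\<And>y. (\<lambda>n. apply_bcontfun y n) \<longlonglongrightarrow> 0 \<Longrightarrow> (\<lambda>n. g n (apply_bcontfun y n)) sums \<Phi> y"
    using null_sequence_functional[of \<Phi>] by metis
  \<comment> \<open>On rank one operators, \<open>\<Phi>\<close> evaluates the tensor of the
    \<open>w n\<close> and \<open>g n\<close>.\<close>
  have gw: "(\<lambda>n. w n x * g n f) sums 0" for x f
  proof -
    have "rank_one f x \<in> span rank_ones" by (intro span_base) (auto simp: rank_ones_def)
    then have "(\<lambda>n. g n (w n o\<^sub>L rank_one f x)) sums 0"
      using g(2)[OF z0, of "rank_one f x"] \<Phi>(1) by (simp add: z)
    moreover have "w n o\<^sub>L rank_one f x = w n x *\<^sub>R f" for n
      by (rule blinfun_eqI) (simp add: blinfun.scaleR_left blinfun.scaleR_right)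
    ultimately show ?thesis by (simp add: blinfun.scaleR_right)
  qed
  have id: "(\<lambda>n. g n (w n)) sums \<Phi> (z id_blinfun)"
  proof -
    have "w n o\<^sub>L id_blinfun = w n" for n by (rule blinfun_eqI) simp
    then show ?thesis using g(2)[OF z0, of id_blinfun] by (simp add: z)
  qed
  define S where "S = (\<Sum>n. norm (g n))"
  have S: "0 \<le> S" unfolding S_def by (intro suminf_nonneg g) auto
  \<comment> \<open>The norm of \<open>w n\<close> is split into two square roots: one makes
    \<open>t n *\<^sub>R sgn (g n)\<close> a null sequence, which with its limit is compact; the
    other is bounded by \<open>sqrt B\<close> and stays with \<open>w n\<close>.\<close>
  define t where "t n = sqrt (norm (w n))" for n
  have t: "0 \<le> t n" "t n * t n = norm (w n)" "t n \<le> sqrt B" for n by (auto simp: t_def B)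
  have t0: "t \<longlonglongrightarrow> 0"
    unfolding t_def using tendsto_real_sqrt[OF tendsto_norm_zero[OF w]] by simp
  have key: "\<Phi> (z id_blinfun) \<le> \<delta> * (sqrt B * S)" if \<delta>: "0 < \<delta>" for \<delta>
  proof -
    have "(\<lambda>n. t n *\<^sub>R sgn (g n)) \<longlonglongrightarrow> 0"
    proof (rule Lim_null_comparison[OF _ t0], rule always_eventually, rule allI)
      show "norm (t n *\<^sub>R sgn (g n)) \<le> t n" for n using t(1)[of n] by (simp add: norm_sgn)
    qed
    then have lim: "limitin euclidean (\<lambda>n. t n *\<^sub>R sgn (g n)) 0 sequentially" by simp
    have "compact (insert 0 (range (\<lambda>n. t n *\<^sub>R sgn (g n))))"
      using compactin_sequence_with_limit[OF lim order_refl] by simp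
    then have "\<exists>v :: (('a \<Rightarrow>\<^sub>L real) \<Rightarrow>\<^sub>L real) \<Rightarrow>\<^sub>L (('a \<Rightarrow>\<^sub>L real) \<Rightarrow>\<^sub>L real). finite_rank v \<and>
        (\<forall>x\<in>insert 0 (range (\<lambda>n. t n *\<^sub>R sgn (g n))). norm (v x - x) \<le> \<delta>)"
      using ap \<delta> unfolding approximation_property_def by blast
    then obtain v :: "(('a \<Rightarrow>\<^sub>L real) \<Rightarrow>\<^sub>L real) \<Rightarrow>\<^sub>L (('a \<Rightarrow>\<^sub>L real) \<Rightarrow>\<^sub>L real)"
      where v: "finite_rank v" "\<And>n. norm (v (t n *\<^sub>R sgn (g n)) - t n *\<^sub>R sgn (g n)) \<le> \<delta>"
      by auto
    \<comment> \<open>Because this trace is zero, subtracting it leaves the value of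
      \<open>\<Phi>\<close> unchanged, whatever \<open>\<delta>\<close> and \<open>v\<close>
      are.\<close>
    have s0: "(\<lambda>n. (v (g n)) (w n)) sums 0"
      by (rule trace_vanishes[OF wB g(1) gw finite_rank_in_span_rank_ones[OF v(1)]])
    have s: "(\<lambda>n. (g n - v (g n)) (w n)) sums \<Phi> (z id_blinfun)"
      using sums_diff[OF id s0] by (simp add: blinfun.diff_left)
    have "(g n - v (g n)) (w n) \<le> norm (g n) * (\<delta> * sqrt B)" for n
    proof -
      have "g n = norm (g n) *\<^sub>R sgn (g n)" by (simp add: norm_scaleR_sgn)
      then have "g n - v (g n) = norm (g n) *\<^sub>R (sgn (g n) - v (sgn (g n)))"
        by (metis blinfun.scaleR_right scaleR_diff_right)
      then have "norm (g n - v (g n)) * t n = norm (g n) * norm (v (t n *\<^sub>R sgn (g n)) - t n *\<^sub>R sgn (g n))"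
        using t(1)[of n]
        by (simp add: blinfun.scaleR_right norm_minus_commute flip: scaleR_diff_right)
      also have "\<dots> \<le> norm (g n) * \<delta>" by (intro mult_left_mono v) auto
      finally have "norm (g n - v (g n)) * t n * t n \<le> (norm (g n) * \<delta>) * sqrt B"
        by (rule mult_mono) (use t(1,3)[of n] \<delta> in auto)
      then show ?thesis
        using norm_blinfun[of "g n - v (g n)" "w n"] t(2)[of n] by (simp add: mult.assoc)
    qed
    then have "\<Phi> (z id_blinfun) \<le> S * (\<delta> * sqrt B)"
      using sums_le[OF _ s sums_mult2[OF summable_sums[OF g(1)]]] by (auto simp: S_def)
    then show ?thesis by (simp add: mult_ac)
  qed
  have "infdist (z id_blinfun) (z ` span rank_ones) < \<epsilon>"
  proof -
    define X where "X = sqrt B * S"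
    have X: "0 \<le> X" using S B0 by (simp add: X_def)
    then have "X / (2 * (X + 1)) < 1" by (simp add: divide_simps)
    then have "\<epsilon> * (X / (2 * (X + 1))) < \<epsilon> * 1" using \<epsilon> by (rule mult_strict_left_mono)
    \<comment> \<open>The choice \<open>\<delta> = \<epsilon> / (2 * (X + 1))\<close> keeps the
      bound below \<open>\<epsilon>\<close>; the summand 1 covers \<open>X = 0\<close>.\<close>
    moreover have "\<Phi> (z id_blinfun) \<le> \<epsilon> / (2 * (X + 1)) * X"
      unfolding X_def by (rule key) (use X \<epsilon> in \<open>auto simp: X_def[symmetric]\<close>)
    ultimately show ?thesis by (simp add: \<Phi>(2))
  qed
  then obtain u where u: "u \<in> span rank_ones" "dist (z id_blinfun) (z u) < \<epsilon>"
    using span_0[of rank_ones]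
    by (auto simp: infdist_def cINF_less_iff split: if_splits)
  show thesis
  proof
    show "u \<in> span rank_ones" by fact
    fix n
    have "norm (w n - (w n o\<^sub>L u)) = norm ((z id_blinfun - z u) n)"
      by (simp add: z) (metis blinfun_apply_id_blinfun blinfun_apply_blinfun_compose blinfun_eqI)
    also have "\<dots> \<le> norm (z id_blinfun - z u)" by (rule norm_bounded)
    finally show "norm (w n - (w n o\<^sub>L u)) \<le> \<epsilon>" using u by (simp add: dist_norm)
  qed
qed

section \<open>Positive functionals on continuous functions\<close>

lemma continuous_on_Max_image:
  fixes f :: "'i \<Rightarrow> 'a::topological_space \<Rightarrow> real"
  assumes "finite A" "A \<noteq> {}" "\<And>i. i \<in> A \<Longrightarrow> continuous_on K (f i)"
  shows "continuous_on K (\<lambda>s. Max ((\<lambda>i. f i s) ` A))"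
  using assms
proof (induction A rule: finite_ne_induct)
  case (insert i A)
  then have "(\<lambda>s. Max ((\<lambda>i. f i s) ` insert i A)) = (\<lambda>s. max (f i s) (Max ((\<lambda>i. f i s) ` A)))"
    by auto
  then show ?case using insert by (auto intro: continuous_on_max)
qed auto

lemma continuous_on_Min_image:
  fixes f :: "'i \<Rightarrow> 'a::topological_space \<Rightarrow> real"
  assumes "finite A" "A \<noteq> {}" "\<And>i. i \<in> A \<Longrightarrow> continuous_on K (f i)"
  shows "continuous_on K (\<lambda>s. Min ((\<lambda>i. f i s) ` A))"
  using assms
proof (induction A rule: finite_ne_induct)
  case (insert i A)
  then have "(\<lambda>s. Min ((\<lambda>i. f i s) ` insert i A)) = (\<lambda>s. min (f i s) (Min ((\<lambda>i. f i s) ` A)))"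
    by auto
  then show ?case using insert by (auto intro: continuous_on_min)
qed auto

text \<open>This stands for integration against a probability measure on \<open>K\<close>. The laws
  concern continuous functions only, so suprema have to be reached through families of such
  functions.\<close>

locale positive_functional =
  fixes K :: "'k::topological_space set" and L :: "('k \<Rightarrow> real) \<Rightarrow> real"
  assumes compact_K: "compact K"
    and add: "continuous_on K f \<Longrightarrow> continuous_on K g \<Longrightarrow> L (\<lambda>s. f s + g s) = L f + L g"
    and scale: "continuous_on K f \<Longrightarrow> L (\<lambda>s. c * f s) = c * L f"
    and mono: "continuous_on K f \<Longrightarrow> continuous_on K g \<Longrightarrow> (\<And>s. s \<in> K \<Longrightarrow> f s \<le> g s) \<Longrightarrow> L f \<le> L g"
    and one: "L (\<lambda>_. 1) = 1"
begin

lemma const: "L (\<lambda>_. c) = c"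
  using scale[of "\<lambda>_. 1" c] by (simp add: one)

lemma diff: "continuous_on K f \<Longrightarrow> continuous_on K g \<Longrightarrow> L (\<lambda>s. f s - g s) = L f - L g"
  using add[of f "\<lambda>s. (-1) * g s"] scale[of g "-1"] by (simp add: continuous_on_minus)

lemma nonneg: "continuous_on K f \<Longrightarrow> (\<And>s. s \<in> K \<Longrightarrow> 0 \<le> f s) \<Longrightarrow> 0 \<le> L f"
  using mono[of "\<lambda>_. 0" f] by (simp add: const)

lemma sum: "(\<And>i. i \<in> A \<Longrightarrow> continuous_on K (f i)) \<Longrightarrow> L (\<lambda>s. \<Sum>i\<in>A. f i s) = (\<Sum>i\<in>A. L (f i))"
proof (induction A rule: infinite_finite_induct)
  case (insert i A)
  then have "L (\<lambda>s. f i s + (\<Sum>i\<in>A. f i s)) = L (f i) + L (\<lambda>s. \<Sum>i\<in>A. f i s)"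
    by (intro add continuous_on_sum) auto
  then show ?case using insert by simp
qed (simp_all add: const)

text \<open>The relatively open sets where \<open>g\<close> exceeds \<open>f\<close> cover
  \<open>K\<close>; an upper bound in \<open>G\<close> of the finitely many members of a subcover
  works everywhere. Directedness replaces the usual monotone sequence.\<close>

lemma Dini:
  fixes f :: "'k \<Rightarrow> real"
  assumes f: "continuous_on K f" and G: "\<And>g. g \<in> G \<Longrightarrow> continuous_on K g" and ne: "G \<noteq> {}"
    and dir: "\<And>g h. g \<in> G \<Longrightarrow> h \<in> G \<Longrightarrow> \<exists>k\<in>G. \<forall>s\<in>K. g s \<le> k s \<and> h s \<le> k s"
    and pt: "\<And>s. s \<in> K \<Longrightarrow> \<exists>g\<in>G. f s < g s"
  shows "\<exists>g\<in>G. \<forall>s\<in>K. f s < g s"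
proof -
  have "\<exists>U. open U \<and> U \<inter> K = {s \<in> K. f s < g s}" if "g \<in> G" for g
  proof -
    have "openin (top_of_set K) (K \<inter> (\<lambda>s. g s - f s) -` {0<..})"
      using G[OF that] f by (intro continuous_openin_preimage_gen continuous_on_diff) auto
    then obtain U where "open U" "K \<inter> (\<lambda>s. g s - f s) -` {0<..} = K \<inter> U"
      by (auto simp: openin_open)
    then show ?thesis by (intro exI[of _ U]) auto
  qed
  then obtain U where U: "\<And>g. g \<in> G \<Longrightarrow> open (U g)" "\<And>g. g \<in> G \<Longrightarrow> U g \<inter> K = {s \<in> K. f s < g s}"
    by metis
  have "K \<subseteq> \<Union>(U ` G)" using pt U(2) by blast
  then obtain G' where G': "G' \<subseteq> G" "finite G'" "K \<subseteq> \<Union>(U ` G')"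
    using compactE_image[OF compact_K, of G U] U(1) by metis
  have "\<exists>k\<in>G. \<forall>g\<in>G'. \<forall>s\<in>K. g s \<le> k s"
    using G'(2,1)
  proof (induction G' rule: finite_induct)
    case empty
    then show ?case using ne by auto
  next
    case (insert h G')
    then obtain k where k: "k \<in> G" "\<forall>g\<in>G'. \<forall>s\<in>K. g s \<le> k s" by auto
    obtain l where l: "l \<in> G" "\<forall>s\<in>K. h s \<le> l s \<and> k s \<le> l s" using dir[of h k] insert k by auto
    show ?case using k l by (auto intro!: bexI[of _ l] intro: order_trans)
  qed
  then obtain k where k: "k \<in> G" "\<forall>g\<in>G'. \<forall>s\<in>K. g s \<le> k s" by blast
  have "f s < k s" if s: "s \<in> K" for s
  proof -
    obtain g where g: "g \<in> G'" "s \<in> U g" using G'(3) s by auto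
    then have "f s < g s" using U(2)[of g] G' s by blast
    also have "\<dots> \<le> k s" using k g s by auto
    finally show ?thesis .
  qed
  with k show ?thesis by blast
qed

text \<open>The closed support of the measure behind \<open>L\<close>, expressed through test
  functions.\<close>

definition support :: "'k set" where
  "support = {s \<in> K. \<forall>f. continuous_on K f \<longrightarrow> (\<forall>t\<in>K. 0 \<le> f t) \<longrightarrow> 0 < f s \<longrightarrow> 0 < L f}"

lemma supportD:
  assumes "s \<in> support" "continuous_on K f" "\<And>t. t \<in> K \<Longrightarrow> 0 \<le> f t" "L f = 0"
  shows "f s = 0"
  using assms by (force simp: support_def)

text \<open>Off the support, multiples of functions with zero integral dominate everything, so that
  Dini's theorem needs pointwise domination on the support only.\<close>

lemma le_of_directed:
  assumes f: "continuous_on K f" and G: "\<And>g. g \<in> G \<Longrightarrow> continuous_on K g" and ne: "G \<noteq> {}"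
    and dir: "\<And>g h. g \<in> G \<Longrightarrow> h \<in> G \<Longrightarrow> \<exists>k\<in>G. \<forall>s\<in>K. g s \<le> k s \<and> h s \<le> k s"
    and pt: "\<And>s e. s \<in> support \<Longrightarrow> 0 < e \<Longrightarrow> \<exists>g\<in>G. f s < g s + e"
    and c: "\<And>g. g \<in> G \<Longrightarrow> L g \<le> c"
  shows "L f \<le> c"
proof (rule field_le_epsilon)
  fix e :: real assume e: "0 < e"
  define N where "N = {n. continuous_on K n \<and> (\<forall>t\<in>K. 0 \<le> n t) \<and> L n = 0}"
  have N0: "(\<lambda>_. 0) \<in> N" by (simp add: N_def const)
  have Nadd: "(\<lambda>s. m s + n s) \<in> N" if "m \<in> N" "n \<in> N" for m n
    using that by (auto simp: N_def add intro: continuous_on_add)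
  define H where "H = {\<lambda>s. g s + n s + e |g n. g \<in> G \<and> n \<in> N}"
  have "\<exists>h\<in>H. \<forall>s\<in>K. f s < h s"
  proof (rule Dini[OF f])
    show "continuous_on K h" if "h \<in> H" for h
      using that G by (auto simp: H_def N_def intro!: continuous_intros)
    show "H \<noteq> {}" using ne N0 by (auto simp: H_def)
  next
    fix g h assume "g \<in> H" "h \<in> H"
    then obtain g' m h' n where g: "g = (\<lambda>s. g' s + m s + e)" "g' \<in> G" "m \<in> N"
      and h: "h = (\<lambda>s. h' s + n s + e)" "h' \<in> G" "n \<in> N" by (auto simp: H_def)
    obtain k where k: "k \<in> G" "\<forall>s\<in>K. g' s \<le> k s \<and> h' s \<le> k s" using dir g h by blast
    have "(\<lambda>s. k s + (m s + n s) + e) \<in> H" using k(1) Nadd[OF g(3) h(3)] by (auto simp: H_def)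
    moreover have "g s \<le> k s + (m s + n s) + e \<and> h s \<le> k s + (m s + n s) + e" if "s \<in> K" for s
      using k(2) g h that by (fastforce simp: N_def)
    ultimately show "\<exists>k\<in>H. \<forall>s\<in>K. g s \<le> k s \<and> h s \<le> k s" by (intro bexI[rotated]) auto
  next
    fix s assume s: "s \<in> K"
    show "\<exists>h\<in>H. f s < h s"
    proof (cases "s \<in> support")
      case True
      then obtain g where g: "g \<in> G" "f s < g s + e" using pt e by blast
      then have "(\<lambda>s. g s + 0 + e) \<in> H" unfolding H_def using N0 by fastforce
      then show ?thesis using g by (intro bexI[rotated]) auto
    next
      case False
      then obtain n where n: "continuous_on K n" "\<forall>t\<in>K. 0 \<le> n t" "0 < n s" "L n \<le> 0"
        using s by (auto simp: support_def not_less)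
      then have "L n = 0" using nonneg[of n] by force
      obtain g where g: "g \<in> G" using ne by blast
      define M where "M = (\<bar>f s\<bar> + \<bar>g s\<bar>) / n s"
      have "(\<lambda>s. M * n s) \<in> N"
      proof -
        have "0 \<le> M" using n by (simp add: M_def)
        then show ?thesis
          using n scale[of n M] \<open>L n = 0\<close> by (auto simp: N_def intro!: continuous_intros)
      qed
      then have "(\<lambda>s. g s + M * n s + e) \<in> H" using g unfolding H_def by fastforce
      moreover have "M * n s = \<bar>f s\<bar> + \<bar>g s\<bar>" using n by (simp add: M_def)
      then have "f s < g s + M * n s + e" using e by linarith
      ultimately show ?thesis by (intro bexI[rotated])
    qed
  qed
  then obtain g n where g: "g \<in> G" and n: "n \<in> N" and le: "\<forall>s\<in>K. f s < g s + n s + e"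
    by (auto simp: H_def)
  have cg: "continuous_on K g" and cn: "continuous_on K n" and n0: "L n = 0"
    using G[OF g] n by (auto simp: N_def)
  have "L f \<le> L (\<lambda>s. g s + n s + e)"
    using le by (intro mono f continuous_intros cg cn) (auto intro: less_imp_le)
  also have "\<dots> = L (\<lambda>s. g s + n s) + L (\<lambda>_. e)" by (intro add continuous_intros cg cn)
  also have "\<dots> = L g + e" using add[OF cg cn] n0 by (simp add: const)
  also have "\<dots> \<le> c + e" using c[OF g] by simp
  finally show "L f \<le> c + e" .
qed

text \<open>The suprema over \<open>A\<close> need not be continuous, so Dini's theorem
  is applied to minima of functions \<open>e N (A N)\<close> whose integrals almost attain the suprema.\<close>

lemma directed_bounded_convergence:
  fixes e :: "nat \<Rightarrow> 'i set \<Rightarrow> 'k \<Rightarrow> real"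
  assumes e: "\<And>N A. finite A \<Longrightarrow> continuous_on K (e N A)"
    and anti: "\<And>N A s. finite A \<Longrightarrow> s \<in> K \<Longrightarrow> e (Suc N) A s \<le> e N A s"
    and mon: "\<And>N A B s. finite B \<Longrightarrow> A \<subseteq> B \<Longrightarrow> s \<in> K \<Longrightarrow> e N A s \<le> e N B s"
    and bd: "\<And>N A s. finite A \<Longrightarrow> s \<in> K \<Longrightarrow> e N A s \<le> b"
    and lim: "\<And>s d. s \<in> support \<Longrightarrow> 0 < d \<Longrightarrow> \<exists>N. \<forall>A. finite A \<longrightarrow> e N A s < d"
    and d: "0 < d"
  shows "\<exists>N. \<forall>A. finite A \<longrightarrow> L (e N A) \<le> d"
proof (rule ccontr)
  assume "\<not> ?thesis"
  then have big: "\<exists>A. finite A \<and> d < L (e N A)" for N by (meson not_less)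
  define a where "a N = (SUP A\<in>{A. finite A}. L (e N A))" for N
  have "bdd_above ((\<lambda>A. L (e N A)) ` {A. finite A})" for N
    using mono[OF e continuous_on_const bd, of _ N] by (intro bdd_aboveI2[where M = b]) (auto simp: const)
  note bda = this
  have aup: "L (e N A) \<le> a N" if "finite A" for N A
    unfolding a_def by (rule cSUP_upper[OF _ bda]) (use that in auto)
  have ad: "d < a N" for N using big[of N] aup[of _ N] less_le_trans by blast
  \<comment> \<open>The allowed deficits \<open>d / 2 ^ (N + 2)\<close> add up to
    \<open>d / 2\<close>, half of the lower bound \<open>d\<close> for all
    \<open>a N\<close>.\<close>
  have "\<exists>A. finite A \<and> a N - d / 2 ^ (N + 2) < L (e N A)" for N
  proof -
    have "a N - d / 2 ^ (N + 2) < a N" using d by simp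
    moreover have "{A :: 'i set. finite A} \<noteq> {}" by auto
    ultimately show ?thesis
      using less_cSUP_iff[OF _ bda, of "a N - d / 2 ^ (N + 2)" N] by (auto simp: a_def)
  qed
  then obtain A where fin: "\<And>N. finite (A N)" and A: "\<And>N. a N - d / 2 ^ (N + 2) < L (e N (A N))"
    by metis
  \<comment> \<open>Running minima give the monotonicity in \<open>N\<close> that the separate
    choices \<open>A N\<close> lack.\<close>
  define h where "h = rec_nat (e 0 (A 0)) (\<lambda>N h s. min (h s) (e (Suc N) (A (Suc N)) s))"
  have h0: "h 0 = e 0 (A 0)" and hS: "h (Suc N) = (\<lambda>s. min (h N s) (e (Suc N) (A (Suc N)) s))" for N
    by (simp_all add: h_def)
  have hc: "continuous_on K (h N)" for N
    by (induction N) (auto simp: h0 hS e fin intro!: continuous_on_min)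
  have hle: "h N s \<le> e N (A N) s" for N s by (cases N) (simp_all add: h0 hS)
  have hdec: "h (N + k) s \<le> h N s" for N k s
    by (induction k) (auto simp: hS min.coboundedI1)
  have "a N - d * (1/2 - 1 / 2 ^ (N + 2)) \<le> L (h N)" for N
  proof (induction N)
    case 0
    then show ?case using A[of 0] by (simp add: h0 field_simps)
  next
    case (Suc N)
    let ?e = "e (Suc N) (A (Suc N))"
    have ce: "continuous_on K ?e" by (rule e[OF fin])
    \<comment> \<open>Minimum and maximum add up to the sum, so an upper bound for the maximum
      limits the loss. At level \<open>N\<close> the union of both index sets dominates the maximum,
      whose integral is thus at most \<open>a N\<close>.\<close>
    have "L (\<lambda>s. max (h N s) (?e s)) \<le> L (e N (A N \<union> A (Suc N)))"
    proof (intro mono continuous_on_max hc ce e)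
      fix s assume s: "s \<in> K"
      have "?e s \<le> e N (A (Suc N)) s" by (rule anti[OF fin s])
      also have "\<dots> \<le> e N (A N \<union> A (Suc N)) s" by (rule mon) (use fin s in auto)
      finally have "?e s \<le> e N (A N \<union> A (Suc N)) s" .
      moreover have "h N s \<le> e N (A N \<union> A (Suc N)) s"
        by (rule order_trans[OF hle]) (rule mon, use fin s in auto)
      ultimately show "max (h N s) (?e s) \<le> e N (A N \<union> A (Suc N)) s" by simp
    qed (use fin in auto)
    also have "\<dots> \<le> a N" by (rule aup) (use fin in auto)
    finally have mx: "L (\<lambda>s. max (h N s) (?e s)) \<le> a N" .
    have "h (Suc N) = (\<lambda>s. (h N s + ?e s) - max (h N s) (?e s))" by (auto simp: hS fun_eq_iff min_def max_def)
    then have "L (h (Suc N)) = L (\<lambda>s. h N s + ?e s) - L (\<lambda>s. max (h N s) (?e s))"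
      by (simp only:) (intro diff continuous_intros hc ce continuous_on_max)
    also have "L (\<lambda>s. h N s + ?e s) = L (h N) + L ?e" by (intro add hc ce)
    finally have hN: "L (h (Suc N)) = L (h N) + L ?e - L (\<lambda>s. max (h N s) (?e s))" .
    define q where "q = d / 2 ^ (N + 2)"
    have q: "d * (1/2 - 1 / 2 ^ (N + 2)) = d / 2 - q" "d * (1/2 - 1 / 2 ^ (Suc N + 2)) = d / 2 - q / 2"
      "d / 2 ^ (Suc N + 2) = q / 2"
      by (simp_all add: q_def field_simps)
    show ?case using Suc A[of "Suc N"] mx hN unfolding q by linarith
  qed
  then have low: "d / 2 \<le> L (h N)" for N
  proof -
    have "d * (1/2 - 1 / 2 ^ (N + 2)) \<le> d / 2" using d by (simp add: field_simps)
    then show ?thesis using ad[of N] \<open>\<And>N. a N - d * (1/2 - 1 / 2 ^ (N + 2)) \<le> L (h N)\<close>[of N] by linarith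
  qed
  \<comment> \<open>The functions \<open>- h N\<close> are directed and on the support exceed 0 up
    to any error, while their integrals stay below \<open>- d / 2\<close>.\<close>
  have "L (\<lambda>_. 0) \<le> - d / 2"
  proof (rule le_of_directed[where G = "range (\<lambda>N s. - h N s)"])
    fix g h' assume "g \<in> range (\<lambda>N s. - h N s)" "h' \<in> range (\<lambda>N s. - h N s)"
    then obtain m n where "g = (\<lambda>s. - h m s)" "h' = (\<lambda>s. - h n s)" by auto
    then show "\<exists>k\<in>range (\<lambda>N s. - h N s). \<forall>s\<in>K. g s \<le> k s \<and> h' s \<le> k s"
      using hdec[of m n] hdec[of n m] by (intro bexI[of _ "\<lambda>s. - h (m + n) s"]) (auto simp: add.commute)
  next
    fix s and \<delta> :: real assume "s \<in> support" "0 < \<delta>"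
    then obtain N where "\<forall>A. finite A \<longrightarrow> e N A s < \<delta>" using lim by blast
    then have "h N s < \<delta>" using hle[of N s] fin[of N] le_less_trans by blast
    then show "\<exists>g\<in>range (\<lambda>N s. - h N s). 0 < g s + \<delta>"
      by (intro bexI[of _ "\<lambda>s. - h N s"]) auto
  next
    fix g assume "g \<in> range (\<lambda>N s. - h N s)"
    then obtain N where "g = (\<lambda>s. - 1 * h N s)" by auto
    then show "L g \<le> - d / 2" using scale[OF hc[of N], of "- 1"] low[of N] by simp
  qed (auto intro: continuous_on_minus hc)
  then show False using d by (simp add: const)
qed

end

section \<open>Pietsch domination\<close>

text \<open>As plain functions the functionals carry the product topology, which is the weak-*
  topology.\<close>

definition dual_ball :: "('a::real_normed_vector \<Rightarrow> real) set" where
  "dual_ball = blinfun_apply ` {f :: 'a \<Rightarrow>\<^sub>L real. norm f \<le> 1}"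

lemma dual_ballI: "norm f \<le> 1 \<Longrightarrow> blinfun_apply f \<in> dual_ball"
  by (auto simp: dual_ball_def)

lemma dual_ballE:
  assumes "s \<in> dual_ball"
  obtains f where "s = blinfun_apply f" "norm f \<le> 1"
  using assms by (auto simp: dual_ball_def)

lemma blinfun_apply_le_norm: "norm f \<le> 1 \<Longrightarrow> \<bar>f x\<bar> \<le> norm x" for f :: "'a::real_normed_vector \<Rightarrow>\<^sub>L real"
  using norm_blinfun[of f x] mult_right_mono[of "norm f" 1 "norm x"] by simp

lemma continuous_on_eval: "continuous_on S (\<lambda>s :: 'a \<Rightarrow> real. s x)"
  by (rule continuous_on_product_then_coordinatewise) (rule continuous_on_id)

text \<open>Banach-Alaoglu: additivity and homogeneity are closed conditions, and the bounds by
  \<open>norm x\<close> place the functions in a product of compact intervals.\<close>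

lemma compact_dual_ball: "compact (dual_ball :: ('a::real_normed_vector \<Rightarrow> real) set)"
proof -
  let ?B = "Pi\<^sub>E (UNIV :: 'a set) (\<lambda>x. {- norm x .. norm x})"
  let ?A = "\<Inter>x y. {s :: 'a \<Rightarrow> real. s (x + y) = s x + s y}"
  let ?S = "\<Inter>c x. {s :: 'a \<Rightarrow> real. s (c *\<^sub>R x) = c * s x}"
  have "compactin (product_topology (\<lambda>i::'a. euclidean::real topology) UNIV) ?B"
    by (subst compactin_PiE) auto
  then have B: "compact ?B" by (simp add: euclidean_product_topology)
  have C: "closed (?A \<inter> ?S)"
    by (intro closed_Int closed_INT ballI closed_Collect_eq continuous_intros continuous_on_eval)
  have "dual_ball = ?B \<inter> (?A \<inter> ?S)"
  proof (intro set_eqI iffI)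
    fix s assume "s \<in> ?B \<inter> (?A \<inter> ?S)"
    then have s: "\<And>x. \<bar>s x\<bar> \<le> norm x" "\<And>x y. s (x + y) = s x + s y" "\<And>c x. s (c *\<^sub>R x) = c * s x"
      by (auto simp: PiE_iff abs_le_iff minus_le_iff)
    have bl: "bounded_linear s"
      by (rule bounded_linear_intro[where K = 1]) (use s in auto)
    then have "norm (Blinfun s) \<le> 1"
      by (intro norm_blinfun_bound) (auto simp: bounded_linear_Blinfun_apply s)
    then show "s \<in> dual_ball" using dual_ballI[of "Blinfun s"] bl by (simp add: bounded_linear_Blinfun_apply)
  next
    fix s :: "'a \<Rightarrow> real" assume "s \<in> dual_ball"
    then obtain f where f: "s = blinfun_apply f" "norm f \<le> 1" by (rule dual_ballE)
    have "- norm x \<le> f x \<and> f x \<le> norm x" for x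
      using blinfun_apply_le_norm[OF f(2), of x] by linarith
    then have "s \<in> ?B" by (simp add: PiE_iff f(1))
    then show "s \<in> ?B \<inter> (?A \<inter> ?S)" by (simp add: f(1) blinfun.add_right blinfun.scaleR_right)
  qed
  then show ?thesis using compact_Int_closed[OF B C] by simp
qed

lemma continuous_on_eval_powr: "0 < p \<Longrightarrow> continuous_on S (\<lambda>s :: 'a \<Rightarrow> real. \<bar>s x\<bar> powr p)"
  by (intro continuous_on_powr' continuous_intros continuous_on_eval) auto

text \<open>Scalar multiplication on function types makes the continuous functions a subspace to
  which the Hahn-Banach theorem applies.\<close>

instantiation "fun" :: (type, real_vector) real_vector
begin

definition "scaleR c f = (\<lambda>x. c *\<^sub>R f x)"

instance
  by standard (auto simp: scaleR_fun_def fun_eq_iff scaleR_add_right scaleR_add_left)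

end

text \<open>The Hahn-Banach theorem separates the negative constants from the cone of sums of the functions
  \<open>s \<mapsto> c\<^sup>p \<bar>s x\<bar>\<^sup>p - \<parallel>\<psi> x\<parallel>\<^sup>p\<close>, none of which is negative everywhere.\<close>

theorem pietsch_domination:
  fixes \<psi> :: "'a::real_normed_vector \<Rightarrow>\<^sub>L 'b::real_normed_vector"
  assumes p: "1 \<le> p" and c: "c \<in> summing_constants p \<psi>"
  obtains L where "positive_functional dual_ball L"
    "\<And>x. norm (\<psi> x) powr p \<le> c powr p * L (\<lambda>s. \<bar>s x\<bar> powr p)"
proof -
  let ?K = "dual_ball :: ('a \<Rightarrow> real) set"
  define V where "V = {f :: ('a \<Rightarrow> real) \<Rightarrow> real. continuous_on ?K f}"
  have V: "subspace V"
    by (rule subspaceI)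
      (auto simp: V_def scaleR_fun_def plus_fun_def zero_fun_def intro!: continuous_intros)
  have c0: "0 \<le> c" using c by (simp add: summing_constants_def)
  have ne: "?K \<noteq> {}" using dual_ballI[of 0] by auto
  define S where "S f = (SUP s\<in>?K. f s)" for f :: "('a \<Rightarrow> real) \<Rightarrow> real"
  have bd: "\<exists>M. \<forall>s\<in>?K. \<bar>f s\<bar> \<le> M" if "f \<in> V" for f
    using compact_imp_bounded[OF compact_continuous_image[OF _ compact_dual_ball, of f]] that
    by (auto simp: V_def bounded_iff)
  have Su: "f s \<le> S f" if fV: "f \<in> V" and "s \<in> ?K" for f s
  proof -
    obtain M where "\<forall>s\<in>?K. \<bar>f s\<bar> \<le> M" using bd[OF fV] by blast
    then have "bdd_above (f ` ?K)" by (intro bdd_aboveI2[where M = M]) (simp add: abs_le_iff)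
    then show ?thesis unfolding S_def using that by (intro cSUP_upper)
  qed
  have Sl: "S f \<le> M" if "\<And>s. s \<in> ?K \<Longrightarrow> f s \<le> M" for f M
    unfolding S_def using that ne by (intro cSUP_least)
  \<comment> \<open>Lists parametrise the cone: appending adds the functions and, on the dual ball,
    scaling all entries by \<open>t powr (1 / p)\<close> multiplies them by
    \<open>t\<close>.\<close>
  define q where "q xs s = (\<Sum>x\<leftarrow>xs. c powr p * \<bar>s x\<bar> powr p - norm (\<psi> x) powr p)"
    for xs and s :: "'a \<Rightarrow> real"
  have q: "q xs \<in> V" for xs
  proof -
    have "continuous_on ?K (\<lambda>s. \<Sum>x\<leftarrow>xs. c powr p * \<bar>s x\<bar> powr p - norm (\<psi> x) powr p)"
      using p by (induction xs) (auto intro!: continuous_intros continuous_on_eval_powr)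
    then show ?thesis by (simp add: V_def q_def[abs_def])
  qed
  \<comment> \<open>Otherwise the entries of \<open>xs\<close> would violate the summing inequality
    for \<open>c\<close>.\<close>
  have S0: "- e < S (q xs)" if e: "0 < e" for xs e
  proof (rule ccontr)
    assume "\<not> ?thesis"
    then have neg: "q xs s \<le> - e" if "s \<in> ?K" for s using Su[OF q that, of xs] by simp
    define n where "n = length xs"
    define T where "T = (\<Sum>k<n. norm (\<psi> (xs ! k)) powr p)"
    have qe: "q xs s = c powr p * (\<Sum>k<n. \<bar>s (xs ! k)\<bar> powr p) - T" for s
      by (simp add: q_def n_def T_def sum_list_sum_nth atLeast0LessThan sum_subtractf sum_distrib_left)
    have le: "c * (\<Sum>k<n. \<bar>f (xs ! k)\<bar> powr p) powr (1 / p) \<le> (T - e) powr (1 / p)"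
      if "norm f \<le> 1" for f :: "'a \<Rightarrow>\<^sub>L real"
    proof -
      have "c * (\<Sum>k<n. \<bar>f (xs ! k)\<bar> powr p) powr (1 / p)
          = (c powr p * (\<Sum>k<n. \<bar>f (xs ! k)\<bar> powr p)) powr (1 / p)"
        using p c0 by (simp add: powr_mult powr_powr sum_nonneg)
      also have "\<dots> \<le> (T - e) powr (1 / p)"
        using neg[OF dual_ballI[OF that]] p
        by (intro powr_mono2) (auto simp: qe intro!: mult_nonneg_nonneg sum_nonneg)
      finally show ?thesis .
    qed
    have "c * weak_p_norm p n (\<lambda>k. xs ! k) \<le> (T - e) powr (1 / p)"
    proof (cases "c = 0")
      case False
      then have "0 < c" using c0 by simp
      then have "weak_p_norm p n (\<lambda>k. xs ! k) \<le> (T - e) powr (1 / p) / c"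
        unfolding weak_p_norm_def using le
        by (intro cSUP_least) (auto simp: field_simps intro: exI[of _ 0])
      then show ?thesis using \<open>0 < c\<close> by (simp add: field_simps)
    qed simp
    moreover have "T powr (1 / p) \<le> c * weak_p_norm p n (\<lambda>k. xs ! k)"
      using c by (simp add: summing_constants_def T_def)
    \<comment> \<open>The zero functional gives \<open>e \<le> T\<close>, so that strict
      monotonicity of \<open>powr\<close> applies.\<close>
    moreover have "0 \<le> T - e"
    proof -
      have "q xs (blinfun_apply 0) \<le> - e" by (intro neg dual_ballI) simp
      then show ?thesis using p by (simp add: qe)
    qed
    then have "(T - e) powr (1 / p) < T powr (1 / p)" using e p by (intro powr_less_mono2) auto
    ultimately show False by simp
  qed
  \<comment> \<open>The infimum over the cone forces nonnegativity there, since
    \<open>P (- q xs) \<le> S 0 = 0\<close>. As \<open>P\<close> is also at most \<open>S\<close>, a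
    linear functional below it is positive and normalised.\<close>
  define P where "P f = (INF xs. S (f + q xs))" for f
  have Ple: "P f \<le> S (f + q xs)" if fV: "f \<in> V" for f xs
  proof -
    obtain M where M: "\<forall>s\<in>?K. \<bar>f s\<bar> \<le> M" using bd[OF fV] by blast
    have "- M - 1 \<le> S (f + q ys)" for ys
    proof -
      have "q ys s \<le> S (f + q ys) + M" if "s \<in> ?K" for s
        using Su[OF subspace_add[OF V fV q] that, of ys] M that by (force simp: abs_le_iff)
      then have "S (q ys) \<le> S (f + q ys) + M" by (rule Sl)
      then show ?thesis using S0[of 1 ys] by simp
    qed
    then have "bdd_below (range (\<lambda>xs. S (f + q xs)))" by (intro bdd_belowI2)
    then show ?thesis unfolding P_def by (rule cINF_lower) simp
  qed
  have Pge: "M \<le> P f" if "\<And>xs. M \<le> S (f + q xs)" for M f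
    unfolding P_def using that by (intro cINF_greatest) auto
  have "sublinear_on V P"
  proof (rule sublinear_onI)
    fix f g assume f: "f \<in> V" and g: "g \<in> V"
    have *: "P (f + g) \<le> S (f + q xs) + S (g + q ys)" for xs ys
    proof -
      have "P (f + g) \<le> S (f + g + q (xs @ ys))" by (intro Ple subspace_add V f g)
      also have "\<dots> \<le> S (f + q xs) + S (g + q ys)"
      proof (rule Sl)
        fix s assume s: "s \<in> ?K"
        show "(f + g + q (xs @ ys)) s \<le> S (f + q xs) + S (g + q ys)"
          using Su[OF subspace_add[OF V f q] s, of xs] Su[OF subspace_add[OF V g q] s, of ys]
          by (simp add: q_def)
      qed
      finally show ?thesis .
    qed
    have "P (f + g) - S (f + q xs) \<le> P g" for xs using * by (intro Pge) (simp add: diff_le_eq add.commute)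
    then have "P (f + g) - P g \<le> P f" by (intro Pge) (simp add: diff_le_eq add.commute)
    then show "P (f + g) \<le> P f + P g" by simp
  next
    fix f and t :: real assume f: "f \<in> V" and t: "0 < t"
    have "P (t *\<^sub>R f) / t \<le> P f"
    proof (rule Pge)
      fix xs
      have "P (t *\<^sub>R f) \<le> S (t *\<^sub>R f + q (map (\<lambda>x. (t powr (1/p)) *\<^sub>R x) xs))"
        by (intro Ple subspace_scale V f)
      also have "\<dots> \<le> t * S (f + q xs)"
      proof (rule Sl)
        fix s assume s: "s \<in> ?K"
        then obtain h where h: "s = blinfun_apply h" by (rule dual_ballE)
        have "q (map (\<lambda>x. (t powr (1/p)) *\<^sub>R x) xs) s = t * q xs s"
          using p t by (simp add: q_def h blinfun.scaleR_right abs_mult powr_mult powr_powr o_def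
              sum_list_const_mult algebra_simps flip: sum_list_const_mult)
        then have "(t *\<^sub>R f + q (map (\<lambda>x. (t powr (1/p)) *\<^sub>R x) xs)) s = t * (f + q xs) s"
          by (simp add: scaleR_fun_def algebra_simps)
        also have "\<dots> \<le> t * S (f + q xs)"
          using t by (intro mult_left_mono Su[OF subspace_add[OF V f q] s]) auto
        finally show "(t *\<^sub>R f + q (map (\<lambda>x. (t powr (1/p)) *\<^sub>R x) xs)) s \<le> t * S (f + q xs)" .
      qed
      finally show "P (t *\<^sub>R f) / t \<le> S (f + q xs)" using t by (simp add: field_simps)
    qed
    then show "P (t *\<^sub>R f) \<le> t * P f" using t by (simp add: field_simps)
  qed
  then obtain L where LP: "\<And>f. f \<in> V \<Longrightarrow> L f \<le> P f"
    and Ladd: "\<And>f g. f \<in> V \<Longrightarrow> g \<in> V \<Longrightarrow> L (f + g) = L f + L g"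
    and Lsc: "\<And>r f. f \<in> V \<Longrightarrow> L (r *\<^sub>R f) = r * L f"
    using hahn_banach_sublinear[OF _ V] by metis
  have Lsub: "L f \<le> M" if f: "f \<in> V" and le: "\<And>s. s \<in> ?K \<Longrightarrow> f s \<le> M" for f M
  proof -
    have "L f \<le> S (f + q [])" using LP[OF f] Ple[OF f, of "[]"] by simp
    also have "\<dots> \<le> M" by (rule Sl) (simp add: q_def le)
    finally show ?thesis .
  qed
  show thesis
  proof
    show "positive_functional ?K L"
    proof
      show "compact ?K" by (rule compact_dual_ball)
      show "L (\<lambda>s. f s + g s) = L f + L g" if "continuous_on ?K f" "continuous_on ?K g" for f g
        using Ladd[of f g] that by (simp add: V_def plus_fun_def)
      show sc: "L (\<lambda>s. r * f s) = r * L f" if "continuous_on ?K f" for f r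
        using Lsc[of f r] that by (simp add: V_def scaleR_fun_def)
      show "L f \<le> L g" if "continuous_on ?K f" "continuous_on ?K g" "\<And>s. s \<in> ?K \<Longrightarrow> f s \<le> g s" for f g
      proof -
        have fV: "f \<in> V" and gV: "g \<in> V" using that by (auto simp: V_def)
        have "L (f + (- 1) *\<^sub>R g) \<le> 0"
          using that fV gV V by (intro Lsub subspace_add subspace_scale) (auto simp: scaleR_fun_def)
        then show ?thesis using Ladd[OF fV subspace_scale[OF V gV, of "-1"]] Lsc[OF gV, of "-1"] by simp
      qed
      have oV: "(\<lambda>_. 1) \<in> V" by (simp add: V_def)
      have "L ((- 1) *\<^sub>R (\<lambda>_. 1)) \<le> - 1"
        by (intro Lsub subspace_scale V oV) (simp add: scaleR_fun_def)
      then show "L (\<lambda>_. 1) = 1" using Lsub[OF oV, of 1] Lsc[OF oV, of "-1"] by simp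
    qed
    then interpret positive_functional ?K L .
    fix x
    have cx: "continuous_on ?K (\<lambda>s. \<bar>s x\<bar> powr p)" using p by (intro continuous_on_eval_powr) auto
    have "L ((- 1) *\<^sub>R q [x]) \<le> P ((- 1) *\<^sub>R q [x])" by (intro LP subspace_scale V q)
    also have "\<dots> \<le> S ((- 1) *\<^sub>R q [x] + q [x])" by (intro Ple subspace_scale V q)
    also have "\<dots> \<le> 0" by (rule Sl) (simp add: scaleR_fun_def)
    finally have "0 \<le> L (q [x])" using Lsc[OF q, of "-1" "[x]"] by simp
    also have "L (q [x]) = L (\<lambda>s. c powr p * \<bar>s x\<bar> powr p - norm (\<psi> x) powr p)"
      by (simp add: q_def[abs_def])
    also have "\<dots> = L (\<lambda>s. c powr p * \<bar>s x\<bar> powr p) - L (\<lambda>_. norm (\<psi> x) powr p)"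
      by (intro diff continuous_intros cx)
    also have "\<dots> = c powr p * L (\<lambda>s. \<bar>s x\<bar> powr p) - norm (\<psi> x) powr p"
      by (simp add: scale[OF cx] const)
    finally show "norm (\<psi> x) powr p \<le> c powr p * L (\<lambda>s. \<bar>s x\<bar> powr p)" by simp
  qed
qed

section \<open>Norm separability of the support\<close>

context positive_functional
begin

lemma cong_on:
  assumes "continuous_on K f" "continuous_on K g" "\<And>s. s \<in> K \<Longrightarrow> f s = g s"
  shows "L f = L g"
  using assms by (intro antisym mono) auto

end

text \<open>Compactness of the bidual ball gives a cluster point of the images of the
  \<open>x n\<close>, and reflexivity makes it a vector. Tails and closed sets express clustering
  without a choice of subsequence.\<close>

lemma weak_cluster_point:
  fixes x :: "nat \<Rightarrow> 'a::real_normed_vector"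
  assumes refl: "reflexive_space TYPE('a)" and x: "\<And>n. norm (x n) \<le> 1"
  obtains y where "norm y \<le> 1"
    "\<And>f (C :: real set) N. closed C \<Longrightarrow> (\<And>n. N \<le> n \<Longrightarrow> blinfun_apply f (x n) \<in> C) \<Longrightarrow> f y \<in> C"
proof -
  define ev where "ev n = blinfun_apply (bidual_embedding (x n))" for n
  have ev: "ev n f = f (x n)" for n f by (simp add: ev_def bidual_embedding.rep_eq)
  have evb: "ev n \<in> dual_ball" for n
    unfolding ev_def
  proof (intro dual_ballI norm_blinfun_bound)
    show "norm (bidual_embedding (x n) f) \<le> 1 * norm f" for f
      using norm_blinfun[of f "x n"] mult_left_mono[OF x[of n], of "norm f"]
      by (simp add: bidual_embedding.rep_eq)
  qed simp
  have "dual_ball \<inter> (\<Inter>n. closure (ev ` {n..})) \<noteq> {}"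
  proof (rule compact_imp_fip_image[OF compact_dual_ball])
    fix I :: "nat set" assume I: "finite I"
    \<comment> \<open>A single late term lies in all the chosen tails; the inserted 0 covers the
      empty \<open>I\<close>.\<close>
    have "ev (Max (insert 0 I)) \<in> closure (ev ` {n..})" if "n \<in> I" for n
      using that I by (intro closure_subset[THEN subsetD] imageI) auto
    then show "dual_ball \<inter> (\<Inter>n\<in>I. closure (ev ` {n..})) \<noteq> {}" using evb by blast
  qed auto
  then obtain s where s: "s \<in> dual_ball" "\<And>n. s \<in> closure (ev ` {n..})" by blast
  then obtain g where g: "s = blinfun_apply g" "norm g \<le> 1" by (elim dual_ballE)
  obtain y where y: "g = bidual_embedding y" using refl unfolding reflexive_space_def by (metis surjD)
  have sy: "s f = f y" for f by (simp add: g y bidual_embedding.rep_eq)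
  show thesis
  proof
    obtain f :: "'a \<Rightarrow>\<^sub>L real" where f: "norm f \<le> 1" "f y = norm y" using ex_norming_functional by blast
    have "norm y = s f" by (simp add: sy f)
    also have "\<dots> \<le> 1" using blinfun_apply_le_norm[OF g(2), of f] f(1) by (simp add: g(1))
    finally show "norm y \<le> 1" .
    fix f :: "'a \<Rightarrow>\<^sub>L real" and C :: "real set" and N :: nat assume C: "closed C" and N: "\<And>n. N \<le> n \<Longrightarrow> f (x n) \<in> C"
    have "closed ((\<lambda>s :: ('a \<Rightarrow>\<^sub>L real) \<Rightarrow> real. s f) -` C)"
      by (rule closed_vimage[OF C continuous_on_eval])
    moreover have "ev ` {N..} \<subseteq> (\<lambda>s. s f) -` C" using N by (auto simp: ev)
    ultimately have "closure (ev ` {N..}) \<subseteq> (\<lambda>s. s f) -` C" by (intro closure_minimal)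
    then show "f y \<in> C" using s(2)[of N] by (auto simp: sy)
  qed
qed

lemma compact_countable_dense:
  fixes C :: "'a::metric_space set"
  assumes "compact C"
  obtains D where "countable D" "C \<subseteq> closure D"
proof -
  have "\<exists>k. finite k \<and> C \<subseteq> (\<Union>x\<in>k. ball x e)" if "0 < e" for e
    using assms that seq_compact_imp_totally_bounded[of C] by (auto simp: compact_eq_seq_compact_metric)
  then have "\<exists>k. finite k \<and> C \<subseteq> (\<Union>x\<in>k. ball x (1 / real (Suc n)))" for n by simp
  then obtain k where k: "\<And>n. finite (k n)" "\<And>n. C \<subseteq> (\<Union>x\<in>k n. ball x (1 / real (Suc n)))" by metis
  show thesis
  proof
    show "countable (\<Union>n. k n)" using k(1) by (auto intro: countable_finite)
    show "C \<subseteq> closure (\<Union>n. k n)"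
    proof
      fix c assume c: "c \<in> C"
      have "\<exists>d\<in>\<Union>n. k n. dist d c < e" if "0 < e" for e
      proof -
        obtain n where n: "1 / real (Suc n) < e" using \<open>0 < e\<close> by (metis nat_approx_posE)
        obtain d where "d \<in> k n" "dist d c < 1 / real (Suc n)" using k(2)[of n] c by auto
        then show ?thesis using n by (intro bexI[of _ d]) auto
      qed
      then show "c \<in> closure (\<Union>n. k n)" by (simp add: closure_approachable)
    qed
  qed
qed

section \<open>The Gram operator of the functional\<close>

locale dual_functional = positive_functional "dual_ball :: ('a::real_normed_vector \<Rightarrow> real) set" L for L
begin

abbreviation "ball_continuous \<equiv> continuous_on (dual_ball :: ('a \<Rightarrow> real) set)"

lemma ball_continuous_abs: "ball_continuous (\<lambda>s. \<bar>s x - s y\<bar>)"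
  by (intro continuous_intros continuous_on_eval)

lemma ball_continuous_mult: "ball_continuous (\<lambda>s. s x * s y)"
  by (intro continuous_intros continuous_on_eval)

text \<open>The covariance operator of the measure behind \<open>L\<close>. Its quadratic form is
  the integral of the square of \<open>s x\<close>, which detects whether \<open>s x\<close>
  vanishes on the support; in the reflexive case its range approximates the support in norm.\<close>

definition gram :: "'a \<Rightarrow> 'a \<Rightarrow>\<^sub>L real" where
  "gram x = Blinfun (\<lambda>z. L (\<lambda>s. s x * s z))"

lemma abs_mult_le: "\<bar>L (\<lambda>s. s x * s z)\<bar> \<le> L (\<lambda>s. \<bar>s x\<bar>) * norm z"
proof -
  have c: "ball_continuous (\<lambda>s. \<bar>s x\<bar>)" by (intro continuous_intros continuous_on_eval)
  have "\<bar>s x * s z\<bar> \<le> norm z * \<bar>s x\<bar>" if s: "s \<in> dual_ball" for s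
  proof -
    have "\<bar>s z\<bar> \<le> norm z" using s by (elim dual_ballE) (simp add: blinfun_apply_le_norm)
    then have "\<bar>s x\<bar> * \<bar>s z\<bar> \<le> \<bar>s x\<bar> * norm z" by (rule mult_left_mono) simp
    then show ?thesis by (simp add: abs_mult mult.commute)
  qed
  then have le: "s x * s z \<le> norm z * \<bar>s x\<bar>" "- norm z * \<bar>s x\<bar> \<le> s x * s z" if "s \<in> dual_ball" for s
    using that by (force simp: abs_le_iff)+
  have "L (\<lambda>s. s x * s z) \<le> L (\<lambda>s. norm z * \<bar>s x\<bar>)"
    by (intro mono ball_continuous_mult continuous_intros c le)
  moreover have "L (\<lambda>s. - norm z * \<bar>s x\<bar>) \<le> L (\<lambda>s. s x * s z)"
    by (intro mono ball_continuous_mult continuous_intros c le)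
  ultimately show ?thesis
    using scale[OF c, of "norm z"] scale[OF c, of "- norm z"] by (simp add: abs_le_iff mult.commute)
qed

lemma L_mult_add: "L (\<lambda>s. s x * s (y + z)) = L (\<lambda>s. s x * s y) + L (\<lambda>s. s x * s z)"
proof -
  have "L (\<lambda>s. s x * s (y + z)) = L (\<lambda>s. s x * s y + s x * s z)"
    by (intro cong_on continuous_intros ball_continuous_mult)
      (auto elim!: dual_ballE simp: blinfun.add_right algebra_simps)
  also have "\<dots> = L (\<lambda>s. s x * s y) + L (\<lambda>s. s x * s z)" by (intro add ball_continuous_mult)
  finally show ?thesis .
qed

lemma L_mult_scaleR: "L (\<lambda>s. s x * s (c *\<^sub>R y)) = c * L (\<lambda>s. s x * s y)"
proof -
  have "L (\<lambda>s. s x * s (c *\<^sub>R y)) = L (\<lambda>s. c * (s x * s y))"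
    by (intro cong_on continuous_intros ball_continuous_mult)
      (auto elim!: dual_ballE simp: blinfun.scaleR_right algebra_simps)
  also have "\<dots> = c * L (\<lambda>s. s x * s y)" by (intro scale ball_continuous_mult)
  finally show ?thesis .
qed

lemma gram: "gram x z = L (\<lambda>s. s x * s z)"
proof -
  have "bounded_linear (\<lambda>z. L (\<lambda>s. s x * s z))"
    by (rule bounded_linear_intro[where K = "L (\<lambda>s. \<bar>s x\<bar>)"])
      (use abs_mult_le[of x] in \<open>simp_all add: L_mult_add L_mult_scaleR mult.commute[of "norm _"]\<close>)
  then show ?thesis by (simp add: gram_def bounded_linear_Blinfun_apply)
qed

lemma gram_commute: "gram x z = gram z x"
  by (simp add: gram mult.commute)

lemma linear_gram: "linear gram"
  by (rule linearI; rule blinfun_eqI)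
    (simp_all add: gram_commute[of _ i for i] blinfun.add_right blinfun.scaleR_right
      blinfun.add_left blinfun.scaleR_left)

text \<open>Through this bound, convergence in mean becomes norm convergence in the dual.\<close>

lemma norm_gram_le: "norm (gram x) \<le> L (\<lambda>s. \<bar>s x\<bar>)"
  by (rule norm_blinfun_bound)
    (auto simp: gram abs_mult_le intro!: nonneg continuous_intros continuous_on_eval)

lemma support_eq_0:
  assumes "s \<in> support" "gram x x = 0"
  shows "s x = 0"
  using supportD[OF assms(1) ball_continuous_mult[of x x]] assms(2) by (simp add: gram)

lemma support_subset: "support \<subseteq> dual_ball"
  by (auto simp: support_def)

text \<open>Two weak cluster points of a sequence along which all the integrals of \<open>s (x n) * s (x m)\<close>
  converge agree on the support, so such a sequence converges pointwise there.\<close>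

lemma ex_subsequence_converging_on_support:
  assumes refl: "reflexive_space TYPE('a)" and x: "\<And>n. norm (x n :: 'a) \<le> 1"
  shows "\<exists>r y. strict_mono (r :: nat \<Rightarrow> nat) \<and> norm y \<le> 1 \<and>
    (\<forall>s\<in>support. (\<lambda>n. s (x (r n))) \<longlonglongrightarrow> s y)"
proof -
  define G where "G n m = gram (x n) (x m)" for n m
  \<comment> \<open>The rows of the Gram matrix lie in a countable product of intervals, whose
    sequential compactness replaces a diagonal argument.\<close>
  have "compactin (product_topology (\<lambda>i::nat. euclidean::real topology) UNIV) (Pi\<^sub>E UNIV (\<lambda>_. {-1..1}))"
    by (subst compactin_PiE) auto
  then have "compact (Pi\<^sub>E UNIV (\<lambda>_::nat. {-1..1::real}))" by (simp add: euclidean_product_topology)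
  then have "seq_compact (Pi\<^sub>E UNIV (\<lambda>_::nat. {-1..1::real}))" by (rule compact_imp_seq_compact)
  moreover have "G n \<in> Pi\<^sub>E UNIV (\<lambda>_. {-1..1})" for n
  proof -
    have "L (\<lambda>s. \<bar>s (x n)\<bar>) \<le> L (\<lambda>_. 1)"
    proof (rule mono)
      show "\<bar>s (x n)\<bar> \<le> 1" if "s \<in> dual_ball" for s
        using that x[of n] by (elim dual_ballE) (use blinfun_apply_le_norm order_trans in blast)
    qed (intro continuous_intros continuous_on_eval)+
    then have "norm (gram (x n)) \<le> 1" using norm_gram_le[of "x n"] by (simp add: one)
    then have "\<bar>G n m\<bar> \<le> 1" for m
      using blinfun_apply_le_norm[of "gram (x n)" "x m"] x[of m] by (simp add: G_def)
    then show ?thesis by (auto simp: PiE_iff abs_le_iff minus_le_iff)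
  qed
  ultimately obtain \<rho> r where r: "strict_mono (r :: nat \<Rightarrow> nat)" and lim: "(G \<circ> r) \<longlonglongrightarrow> \<rho>"
    unfolding seq_compact_def by metis
  have G: "(\<lambda>n. gram (x m) (x (r n))) \<longlonglongrightarrow> \<rho> m" for m
    using continuous_on_tendsto_compose[OF continuous_on_eval[of UNIV m] lim]
    by (simp add: G_def o_def gram_commute)
  define cluster where "cluster z y \<longleftrightarrow> norm y \<le> 1 \<and> (\<forall>f (C :: real set) N. closed C \<longrightarrow>
      (\<forall>n\<ge>N. blinfun_apply f (z n) \<in> C) \<longrightarrow> f y \<in> C)" for z :: "nat \<Rightarrow> 'a" and y
  have ex: "\<exists>y. cluster z y" if "\<And>n. norm (z n) \<le> 1" for z
    using weak_cluster_point[OF refl, of z] that unfolding cluster_def by metis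
  have lim_eq: "f y = l" if c: "cluster z y" and l: "(\<lambda>n. f (z n)) \<longlonglongrightarrow> l" for f :: "'a \<Rightarrow>\<^sub>L real" and z y l
  proof -
    have "\<bar>f y - l\<bar> \<le> e" if "0 < e" for e
    proof -
      obtain N where "\<And>n. N \<le> n \<Longrightarrow> \<bar>f (z n) - l\<bar> < e" using LIMSEQ_D[OF l \<open>0 < e\<close>] by auto
      then have "\<forall>n\<ge>N. f (z n) \<in> cball l e" by (auto simp: dist_real_def abs_minus_commute less_imp_le)
      then have "f y \<in> cball l e" using c unfolding cluster_def by blast
      then show ?thesis by (simp add: dist_real_def abs_minus_commute)
    qed
    then show ?thesis by (meson abs_le_zero_iff dense_ge eq_iff_diff_eq_0)
  qed
  obtain y where y: "cluster (x \<circ> r) y" using ex[of "x \<circ> r"] x by auto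
  have "(\<lambda>n. s (x (r n))) \<longlonglongrightarrow> s y" if s: "s \<in> support" for s
  proof (rule ccontr)
    assume "\<not> ?thesis"
    then obtain \<delta> where \<delta>: "0 < \<delta>" "\<And>N. \<exists>n\<ge>N. \<delta> \<le> \<bar>s (x (r n)) - s y\<bar>"
      by (auto simp: LIMSEQ_iff not_less)
    have "infinite {n. \<delta> \<le> \<bar>s (x (r n)) - s y\<bar>}"
      unfolding infinite_nat_iff_unbounded_le using \<delta>(2) by auto
    then obtain q where q: "strict_mono (q :: nat \<Rightarrow> nat)" "\<And>n. \<delta> \<le> \<bar>s (x (r (q n))) - s y\<bar>"
      using infinite_enumerate by blast
    obtain y' where y': "cluster (x \<circ> r \<circ> q) y'" using ex[of "x \<circ> r \<circ> q"] x by auto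
    obtain f where f: "s = blinfun_apply f" using s support_subset by (auto elim: dual_ballE)
    have "closed {t. \<delta> \<le> \<bar>t - f y\<bar>}" by (intro closed_Collect_le continuous_intros)
    then have far: "\<delta> \<le> \<bar>f y' - f y\<bar>"
      using y' q(2) unfolding cluster_def f by (elim conjE allE[of _ f] allE[of _ "{t. \<delta> \<le> \<bar>t - f y\<bar>}"]) auto
    \<comment> \<open>Both cluster points have the same Gram limits \<open>\<rho>\<close>, so
      \<open>y - y'\<close> is Gram orthogonal to all \<open>x m\<close> and, by clustering, to
      \<open>y\<close> and \<open>y'\<close> themselves.\<close>
    have "gram (x m) y = \<rho> m" for m using lim_eq[OF y, of "gram (x m)"] G by simp
    moreover have "gram (x m) y' = \<rho> m" for m
      using lim_eq[OF y', of "gram (x m)" "\<rho> m"] LIMSEQ_subseq_LIMSEQ[OF G q(1)] by (simp add: o_def)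
    ultimately have g0: "gram (y - y') (x m) = 0" for m
      by (simp add: gram_commute[of "y - y'"] blinfun.diff_right)
    have "gram (y - y') y = 0" by (rule lim_eq[OF y]) (simp add: g0)
    moreover have "gram (y - y') y' = 0" by (rule lim_eq[OF y']) (simp add: g0)
    ultimately have "gram (y - y') (y - y') = 0" by (simp add: blinfun.diff_right)
    then have "s (y - y') = 0" by (rule support_eq_0[OF s])
    then show False using far \<delta>(1) by (simp add: f blinfun.diff_right)
  qed
  then show ?thesis using r y by (intro exI[of _ r] exI[of _ y]) (simp add: cluster_def)
qed

text \<open>A subsequence converging pointwise on the support converges in mean by
  \<open>directed_bounded_convergence\<close>, and \<open>norm_gram_le\<close> transfers this to the
  dual.\<close>

lemma compact_gram_image:
  assumes refl: "reflexive_space TYPE('a)"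
  shows "compact (gram ` cball 0 1)"
  unfolding compact_eq_seq_compact_metric seq_compact_def
proof (intro allI impI)
  fix g assume "\<forall>n::nat. g n \<in> gram ` cball 0 1"
  then have "\<exists>z. norm z \<le> 1 \<and> g n = gram z" for n by (metis imageE mem_cball_0)
  then obtain x where x: "\<And>n. norm (x n) \<le> 1" and g: "\<And>n. g n = gram (x n)" by metis
  obtain r y where r: "strict_mono (r :: nat \<Rightarrow> nat)" "norm y \<le> 1"
    and lim: "\<And>s. s \<in> support \<Longrightarrow> (\<lambda>n. s (x (r n))) \<longlonglongrightarrow> s y"
    using ex_subsequence_converging_on_support[OF refl, of x] x by blast
  \<comment> \<open>Finite maxima over tails are continuous substitutes for the supremum of the
    remaining deviations. The inserted 0 keeps the index set nonempty.\<close>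
  define e where "e N A s = Max ((\<lambda>i. if N \<le> i then \<bar>s (x (r i)) - s y\<bar> else 0) ` insert 0 A)"
    for N A and s :: "'a \<Rightarrow> real"
  have ec: "ball_continuous (e N A)" if "finite A" for N A
    unfolding e_def
  proof (rule continuous_on_Max_image)
    show "ball_continuous (\<lambda>s. if N \<le> i then \<bar>s (x (r i)) - s y\<bar> else 0)" for i
      by (cases "N \<le> i") (simp_all add: ball_continuous_abs)
  qed (use that in auto)
  have conv: "\<exists>N. \<forall>A. finite A \<longrightarrow> L (e N A) \<le> d" if "0 < d" for d
  proof (rule directed_bounded_convergence[where b = 2])
    show "e (Suc N) A s \<le> e N A s" if "finite A" for N A s
    proof -
      have "(if Suc N \<le> i then \<bar>s (x (r i)) - s y\<bar> else 0) \<le> e N A s" if i: "i \<in> insert 0 A" for i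
      proof -
        have "(if N \<le> i then \<bar>s (x (r i)) - s y\<bar> else 0) \<le> e N A s"
          unfolding e_def using i \<open>finite A\<close> by (intro Max_ge) auto
        moreover have "(if Suc N \<le> i then \<bar>s (x (r i)) - s y\<bar> else 0) \<le> (if N \<le> i then \<bar>s (x (r i)) - s y\<bar> else 0)"
          by simp
        ultimately show ?thesis by linarith
      qed
      then have "v \<le> e N A s"
        if "v \<in> (\<lambda>i. if Suc N \<le> i then \<bar>s (x (r i)) - s y\<bar> else 0) ` insert 0 A" for v
        using that by blast
      then show ?thesis unfolding e_def[of "Suc N"] using \<open>finite A\<close> by (intro Max.boundedI) blast+
    qed
    show "e N A s \<le> e N B s" if "finite B" "A \<subseteq> B" for N A B s
      unfolding e_def using that by (intro Max_mono) auto
    show "e N A s \<le> 2" if "finite A" "s \<in> dual_ball" for N A s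
    proof -
      have sb: "\<bar>s z\<bar> \<le> 1" if "norm z \<le> 1" for z
        using \<open>s \<in> dual_ball\<close> that by (elim dual_ballE) (use blinfun_apply_le_norm order_trans in blast)
      have "\<bar>s (x (r i)) - s y\<bar> \<le> 2" for i
      proof -
        have "\<bar>s (x (r i))\<bar> \<le> 1" "\<bar>s y\<bar> \<le> 1" using sb x r(2) by auto
        then show ?thesis by linarith
      qed
      then show ?thesis unfolding e_def using that(1) by (intro Max.boundedI) auto
    qed
    show "\<exists>N. \<forall>A. finite A \<longrightarrow> e N A s < c" if s: "s \<in> support" and c: "0 < c" for s c
    proof -
      obtain N where "\<And>n. N \<le> n \<Longrightarrow> \<bar>s (x (r n)) - s y\<bar> < c"
        using LIMSEQ_D[OF lim[OF s] c] by auto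
      then show ?thesis unfolding e_def using c by (intro exI[of _ N] allI impI) (subst Max_less_iff, auto)
    qed
  qed (use ec that in auto)
  have "(\<lambda>n. gram (x (r n))) \<longlonglongrightarrow> gram y"
  proof (rule LIMSEQ_I)
    fix d :: real assume "0 < d"
    then obtain N where N: "\<And>A. finite A \<Longrightarrow> L (e N A) \<le> d / 2" using conv[of "d / 2"] by auto
    have "norm (gram (x (r n)) - gram y) < d" if n: "N \<le> n" for n
    proof -
      have "norm (gram (x (r n)) - gram y) \<le> L (\<lambda>s. \<bar>s (x (r n) - y)\<bar>)"
        using norm_gram_le[of "x (r n) - y"] linear_diff[OF linear_gram] by simp
      also have "\<dots> \<le> L (e N {n})"
      proof (intro mono ec)
        show "\<bar>s (x (r n) - y)\<bar> \<le> e N {n} s" if "s \<in> dual_ball" for s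
          using that n by (auto elim!: dual_ballE simp: e_def blinfun.diff_right)
      qed (auto intro: continuous_intros continuous_on_eval)
      also have "\<dots> \<le> d / 2" by (rule N) simp
      finally show ?thesis using \<open>0 < d\<close> by simp
    qed
    then show "\<exists>N. \<forall>n\<ge>N. norm (gram (x (r n)) - gram y) < d" by blast
  qed
  then show "\<exists>l\<in>gram ` cball 0 1. \<exists>r. strict_mono (r :: nat \<Rightarrow> nat) \<and> (g \<circ> r) \<longlonglongrightarrow> l"
    using r by (intro bexI[of _ "gram y"] exI[of _ r]) (auto simp: g o_def)
qed

text \<open>The range of \<open>gram\<close> is separable, being a union of multiples of a compact
  set. By Hahn-Banach and reflexivity, a functional outside its closure is nonzero at some
  \<open>z\<close> with \<open>gram z = 0\<close>; but then \<open>gram z z = 0\<close>, and every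
  functional in the support vanishes at \<open>z\<close>.\<close>

lemma support_separable_reflexive:
  assumes refl: "reflexive_space TYPE('a)"
  obtains D :: "('a \<Rightarrow>\<^sub>L real) set" where "countable D" "\<And>f. blinfun_apply f \<in> support \<Longrightarrow> f \<in> closure D"
proof -
  obtain D where D: "countable D" "gram ` cball 0 1 \<subseteq> closure D"
    using compact_countable_dense[OF compact_gram_image[OF refl]] by blast
  define D' where "D' = (\<Union>n::nat. (\<lambda>d. real n *\<^sub>R d) ` D)"
  have gD: "gram x \<in> closure D'" for x
  proof -
    obtain n :: nat where n: "norm x + 1 \<le> real n" using real_arch_simple by blast
    then have n0: "0 < real n" using norm_ge_zero[of x] by linarith
    have "gram ((1 / real n) *\<^sub>R x) \<in> closure D"
      using D(2) n n0 by (intro subsetD[OF D(2)] imageI) (simp add: field_simps)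
    moreover have "(\<lambda>d. real n *\<^sub>R d) ` closure D \<subseteq> closure D'"
      using closure_scaleR[of "real n" D] closure_mono[of "(\<lambda>d. real n *\<^sub>R d) ` D" D'] by (auto simp: D'_def)
    ultimately have "real n *\<^sub>R gram ((1 / real n) *\<^sub>R x) \<in> closure D'" by blast
    then show ?thesis using n0 by (simp add: linear_cmul[OF linear_gram])
  qed
  show thesis
  proof
    show "countable D'" using D by (auto simp: D'_def)
    fix f :: "'a \<Rightarrow>\<^sub>L real" assume f: "blinfun_apply f \<in> support"
    have R: "subspace (range gram)" by (rule linear_subspace_image[OF linear_gram subspace_UNIV])
    obtain \<Phi> :: "('a \<Rightarrow>\<^sub>L real) \<Rightarrow>\<^sub>L real" where \<Phi>: "\<And>h. h \<in> range gram \<Longrightarrow> \<Phi> h = 0" "\<Phi> f = infdist f (range gram)"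
      using hahn_banach_infdist[OF R, of f] by metis
    obtain z where z: "\<Phi> = bidual_embedding z" using refl unfolding reflexive_space_def by (metis surjD)
    have "gram z z = 0" using \<Phi>(1)[of "gram z"] by (simp add: z bidual_embedding.rep_eq)
    then have "f z = 0" by (rule support_eq_0[OF f])
    then have "infdist f (range gram) = 0" using \<Phi>(2) by (simp add: z bidual_embedding.rep_eq)
    then have "f \<in> closure (range gram)" by (simp add: in_closure_iff_infdist_zero)
    moreover have "closure (range gram) \<subseteq> closure D'" using gD by (intro closure_minimal) auto
    ultimately show "f \<in> closure D'" by blast
  qed
qed

end

section \<open>Approximation of summing operators\<close>

lemma powr_add_le:
  fixes a b p :: real
  assumes "0 \<le> a" "0 \<le> b" "1 \<le> p"
  shows "(a + b) powr p \<le> 2 powr p * (a powr p + b powr p)"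
proof -
  have "(a + b) powr p \<le> (2 * max a b) powr p" using assms by (intro powr_mono2) auto
  also have "\<dots> = 2 powr p * max a b powr p" using assms by (simp add: powr_mult)
  also have "max a b powr p \<le> a powr p + b powr p" by (simp add: max_def)
  finally show ?thesis by (simp add: mult_left_mono)
qed

text \<open>The largest of the weighted terms dominates the whole sum, because the reciprocals of
  the weights \<open>2 ^ Suc j\<close> sum to less than 1.\<close>

lemma sum_powr_le_geometric:
  fixes a :: "nat \<Rightarrow> real"
  assumes "\<And>j. 0 \<le> a j" "1 \<le> p"
  shows "(\<Sum>j\<le>J. a j) powr p \<le> (\<Sum>j\<le>J. (2 ^ Suc j * a j) powr p)"
proof -
  obtain i where i: "i \<le> J" "\<And>j. j \<le> J \<Longrightarrow> 2 ^ Suc j * a j \<le> 2 ^ Suc i * a i"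
  proof -
    have "finite ((\<lambda>j. 2 ^ Suc j * a j) ` {..J})" "(\<lambda>j. 2 ^ Suc j * a j) ` {..J} \<noteq> {}" by auto
    from Max_in[OF this] Max_ge[OF this(1)] show thesis using that by fastforce
  qed
  define m where "m = 2 ^ Suc i * a i"
  have m0: "0 \<le> m" by (simp add: m_def assms)
  have "(\<Sum>j\<le>J. a j) \<le> (\<Sum>j\<le>J. m * (1/2) ^ Suc j)"
    using i(2) by (intro sum_mono) (simp add: m_def field_simps)
  also have "\<dots> = m * (1 - (1/2) ^ Suc J)"
    by (induction J) (simp_all add: field_simps)
  also have "\<dots> \<le> m * 1" using m0 by (intro mult_left_mono) auto
  finally have "(\<Sum>j\<le>J. a j) powr p \<le> m powr p"
    using assms by (intro powr_mono2) (auto intro: sum_nonneg)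
  also have "\<dots> \<le> (\<Sum>j\<le>J. (2 ^ Suc j * a j) powr p)"
    unfolding m_def using i(1) by (intro member_le_sum) auto
  finally show ?thesis .
qed

lemma sum_functional_powr_le:
  fixes h :: "'a::real_normed_vector \<Rightarrow>\<^sub>L real"
  assumes p: "1 \<le> p"
  shows "(\<Sum>k<n. \<bar>h (x k)\<bar> powr p) \<le> norm h powr p * weak_p_norm p n x powr p"
proof -
  let ?S = "\<Sum>k<n. \<bar>sgn h (x k)\<bar> powr p"
  have "?S powr (1 / p) \<le> weak_p_norm p n x"
    unfolding weak_p_norm_def by (rule cSUP_upper[OF _ weak_p_norm_bdd[OF p]]) (simp add: norm_sgn)
  then have "(?S powr (1 / p)) powr p \<le> weak_p_norm p n x powr p" using p by (intro powr_mono2) auto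
  then have S: "?S \<le> weak_p_norm p n x powr p" using p by (simp add: powr_powr sum_nonneg)
  have "h z = norm h * sgn h z" for z
    by (metis blinfun.scaleR_left norm_scaleR_sgn real_scaleR_def)
  then have "(\<Sum>k<n. \<bar>h (x k)\<bar> powr p) = (\<Sum>k<n. \<bar>norm h * sgn h (x k)\<bar> powr p)" by metis
  also have "\<dots> = norm h powr p * ?S"
    by (simp add: abs_mult powr_mult sum_distrib_left)
  also have "\<dots> \<le> norm h powr p * weak_p_norm p n x powr p" by (intro mult_left_mono S) simp
  finally show ?thesis .
qed

section \<open>Uniform boundedness\<close>

lemma banach_steinhaus:
  fixes \<phi> :: "nat \<Rightarrow> 'a::banach \<Rightarrow>\<^sub>L 'b::real_normed_vector"
  assumes "\<And>y. Bseq (\<lambda>n. \<phi> n y)"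
  shows "Bseq \<phi>"
proof -
  define A where "A m = (\<Inter>n. {y. norm (\<phi> n y) \<le> real m})" for m
  have cl: "closed (A m)" for m
    unfolding A_def by (intro closed_INT ballI closed_Collect_le continuous_intros)
  have "\<exists>m. y \<in> A m" for y
  proof -
    obtain K where K: "\<And>n. norm (\<phi> n y) \<le> K" using assms[of y] by (auto simp: Bseq_def)
    obtain m :: nat where "K \<le> real m" using real_arch_simple by blast
    then show ?thesis using K by (auto simp: A_def intro: order_trans)
  qed
  then have U: "\<Union>(range A) = UNIV" by blast
  have "\<exists>m. interior (A m) \<noteq> {}"
  proof (rule ccontr)
    assume no: "\<not> ?thesis"
    have "Met_TC.mtopology interior_of \<Union>(range A) = {}"
      using no cl by (intro Met_TC.metric_Baire_category_alt) (auto simp: complete_UNIV)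
    then show False by (simp add: U)
  qed
  then obtain m x0 where "x0 \<in> interior (A m)" by blast
  then obtain r where r: "0 < r" "cball x0 r \<subseteq> A m" by (auto simp: mem_interior_cball)
  have "norm (\<phi> n) \<le> 2 * real m / r" for n
  proof (rule norm_blinfun_bound)
    show "0 \<le> 2 * real m / r" using r by simp
    fix z
    \<comment> \<open>Two points of \<open>A m\<close> differ by \<open>r *\<^sub>R sgn z\<close>,
      whence the factor 2; \<open>sgn\<close> also covers \<open>z = 0\<close>.\<close>
    have "x0 + r *\<^sub>R sgn z \<in> A m" "x0 \<in> A m" using r by (auto simp: dist_norm norm_sgn)
    then have "norm (\<phi> n (x0 + r *\<^sub>R sgn z)) \<le> real m" "norm (\<phi> n x0) \<le> real m" by (auto simp: A_def)
    then have "norm (\<phi> n (x0 + r *\<^sub>R sgn z) - \<phi> n x0) \<le> 2 * real m"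
      using norm_triangle_ineq4[of "\<phi> n (x0 + r *\<^sub>R sgn z)" "\<phi> n x0"] by linarith
    then have "norm (\<phi> n (sgn z)) \<le> 2 * real m / r"
      using r by (simp add: blinfun.add_right blinfun.scaleR_right field_simps)
    then have "norm (\<phi> n (sgn z)) * norm z \<le> 2 * real m / r * norm z" by (intro mult_right_mono) auto
    moreover have "norm (\<phi> n (norm z *\<^sub>R sgn z)) = norm (\<phi> n (sgn z)) * norm z"
      by (simp add: blinfun.scaleR_right)
    ultimately show "norm (\<phi> n z) \<le> 2 * real m / r * norm z" by (simp add: norm_scaleR_sgn)
  qed
  then show ?thesis by (rule BseqI')
qed

section \<open>Distances to finitely many functionals, and chaining\<close>

context dual_functional
begin

text \<open>The supremum over all finite \<open>A\<close> is the distance of \<open>s\<close> to \<open>{y 0, \<dots>, y N}\<close>, which is only lower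
  semicontinuous; hence the approximations by finite sets of test vectors.\<close>

definition excess :: "(nat \<Rightarrow> 'a \<Rightarrow>\<^sub>L real) \<Rightarrow> nat \<Rightarrow> 'a set \<Rightarrow> ('a \<Rightarrow> real) \<Rightarrow> real" where
  "excess y N A s = Min ((\<lambda>i. Max ((\<lambda>z. \<bar>s z - y i z\<bar>) ` insert 0 {z \<in> A. norm z \<le> 1})) ` {..N})"

lemma continuous_on_excess: "finite A \<Longrightarrow> ball_continuous (excess y N A)"
  unfolding excess_def
  by (intro continuous_on_Min_image continuous_on_Max_image continuous_intros continuous_on_eval) auto

lemma excess_le:
  assumes "finite A" "i \<le> N"
  shows "excess y N A (blinfun_apply f) \<le> norm (f - y i)"
proof -
  have "excess y N A (blinfun_apply f) \<le> Max ((\<lambda>z. \<bar>f z - y i z\<bar>) ` insert 0 {z \<in> A. norm z \<le> 1})"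
    unfolding excess_def using assms by (intro Min_le) auto
  also have "\<dots> \<le> norm (f - y i)"
  proof (rule Max.boundedI)
    fix v assume "v \<in> (\<lambda>z. \<bar>f z - y i z\<bar>) ` insert 0 {z \<in> A. norm z \<le> 1}"
    then obtain z where "z \<in> insert 0 {z \<in> A. norm z \<le> 1}" "v = \<bar>f z - y i z\<bar>" by blast
    then have z: "norm z \<le> 1" "v = \<bar>(f - y i) z\<bar>" by (auto simp: blinfun.diff_left)
    then show "v \<le> norm (f - y i)"
      using norm_blinfun[of "f - y i" z] mult_left_mono[OF z(1), of "norm (f - y i)"] by simp
  qed (use assms in auto)
  finally show ?thesis .
qed

lemma excess_nonneg: "finite A \<Longrightarrow> 0 \<le> excess y N A s"
  unfolding excess_def by (intro Min.boundedI) (auto simp: Max_ge_iff intro!: exI[of _ "\<bar>s 0 - y _ 0\<bar>"])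

lemma excess_antimono: "N \<le> N' \<Longrightarrow> excess y N' A s \<le> excess y N A s"
  unfolding excess_def by (intro Min_antimono) auto

lemma excess_mono:
  assumes "finite B" "A \<subseteq> B"
  shows "excess y N A s \<le> excess y N B s"
proof -
  have "Max ((\<lambda>z. \<bar>s z - y i z\<bar>) ` insert 0 {z \<in> A. norm z \<le> 1})
      \<le> Max ((\<lambda>z. \<bar>s z - y i z\<bar>) ` insert 0 {z \<in> B. norm z \<le> 1})" for i
    using assms by (intro Max_mono) auto
  moreover have "excess y N A s \<le> Max ((\<lambda>z. \<bar>s z - y i z\<bar>) ` insert 0 {z \<in> A. norm z \<le> 1})"
    if "i \<in> {..N}" for i
    unfolding excess_def using that by (intro Min_le) auto
  ultimately have "excess y N A s \<le> Max ((\<lambda>z. \<bar>s z - y i z\<bar>) ` insert 0 {z \<in> B. norm z \<le> 1})"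
    if "i \<in> {..N}" for i
    using that order_trans by blast
  then show ?thesis unfolding excess_def[of y N B] by (intro Min.boundedI) blast+
qed

text \<open>One almost norming vector for each of the finitely many \<open>f - y i\<close> suffices:
  the minimum is attained at some \<open>i\<close>, and the vector chosen for this index witnesses
  the norm.\<close>

lemma excess_approaches:
  assumes "0 < d"
  shows "\<exists>A. finite A \<and> (\<exists>i\<le>N. norm (f - y i) \<le> excess y N A (blinfun_apply f) + d)"
proof -
  have "\<exists>z. norm z \<le> 1 \<and> norm (f - y i) - d < (f - y i) z" for i
    using blinfun_norm_le_functional[of "f - y i" "norm (f - y i) - d"] assms by force
  then obtain z where z: "\<And>i. norm (z i) \<le> 1" "\<And>i. norm (f - y i) - d < (f - y i) (z i)" by metis
  define A where "A = z ` {..N}"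
  have fin: "finite A" by (simp add: A_def)
  have "excess y N A (blinfun_apply f)
      \<in> (\<lambda>i. Max ((\<lambda>z. \<bar>f z - y i z\<bar>) ` insert 0 {z \<in> A. norm z \<le> 1})) ` {..N}"
    unfolding excess_def by (rule Min_in) auto
  then obtain i where i: "i \<le> N" and
    e: "excess y N A (blinfun_apply f) = Max ((\<lambda>z. \<bar>f z - y i z\<bar>) ` insert 0 {z \<in> A. norm z \<le> 1})" by blast
  have "\<bar>f (z i) - y i (z i)\<bar> \<le> excess y N A (blinfun_apply f)"
    unfolding e using fin i z by (intro Max_ge) (auto simp: A_def)
  then show ?thesis using z(2)[of i] i fin by (intro exI[of _ A]) (auto simp: blinfun.diff_left intro!: exI[of _ i])
qed

text \<open>Chaining: along approximations \<open>y (i j)\<close> of a functional in the support, the increments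
  \<open>y (i (j + 1)) - y (i j)\<close> come from finite sets, and normalised with the factor \<open>2\<^sup>-\<^sup>j\<close> they form a
  null sequence. Approximating that sequence controls the approximation of the whole support in mean.\<close>

lemma ex_controlling_null_sequence:
  assumes D: "countable D" "\<And>f :: 'a \<Rightarrow>\<^sub>L real. blinfun_apply f \<in> support \<Longrightarrow> f \<in> closure D"
    and p: "1 \<le> p" "p \<le> 2"
  shows "\<exists>w :: nat \<Rightarrow> 'a \<Rightarrow>\<^sub>L real. w \<longlonglongrightarrow> 0 \<and>
    (\<forall>u \<epsilon> n x. 0 \<le> \<epsilon> \<longrightarrow> (\<forall>m. norm (w m - (w m o\<^sub>L u)) \<le> \<epsilon>) \<longrightarrow>
      L (\<lambda>s. \<Sum>k<n. \<bar>s (x k - u (x k))\<bar> powr p) \<le> 128 * (\<epsilon> powr p * weak_p_norm p n x powr p))"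
proof -
  \<comment> \<open>The leading 0 bounds the excess by 1 on the dual ball and starts every chain;
    \<open>insert 0 D\<close> keeps the enumerated set nonempty.\<close>
  define y where "y i = (case i of 0 \<Rightarrow> 0 | Suc m \<Rightarrow> from_nat_into (insert 0 D) m)" for i
  have y0: "y 0 = 0" by (simp add: y_def)
  have "D \<subseteq> range y"
  proof
    fix d assume "d \<in> D"
    then have "d \<in> range (from_nat_into (insert 0 D))" using D(1) by (simp add: range_from_nat_into)
    then obtain m where "d = y (Suc m)" by (auto simp: y_def)
    then show "d \<in> range y" by blast
  qed
  then have cl: "f \<in> closure (range y)" if "blinfun_apply f \<in> support" for f
    using D(2)[OF that] closure_mono by blast
  have approx: "\<exists>i. norm (f - y i) < d" if "blinfun_apply f \<in> support" "0 < d" for f d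
    using cl[OF that(1)] that(2) by (auto simp: closure_approachable dist_norm norm_minus_commute)
  have "\<exists>N. \<forall>A. finite A \<longrightarrow> L (excess y N A) \<le> d" if "0 < d" for d
  proof (rule directed_bounded_convergence[where b = 1])
    show "excess y N A s \<le> 1" if fin: "finite A" and s: "s \<in> dual_ball" for N A s
    proof -
      obtain f where f: "s = blinfun_apply f" "norm f \<le> 1" using s by (rule dual_ballE)
      then show ?thesis using excess_le[OF fin, of 0 N y f] by (simp add: y0)
    qed
    show "\<exists>N. \<forall>A. finite A \<longrightarrow> excess y N A s < c" if s: "s \<in> support" and c: "0 < c" for s c
    proof -
      obtain f where f: "s = blinfun_apply f" using s support_subset by (auto elim: dual_ballE)
      then obtain i where "norm (f - y i) < c" using approx s c by blast
      then show ?thesis using excess_le[of _ i i y f] unfolding f by (meson le_less_trans order_refl)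
    qed
  qed (use that in \<open>auto intro: continuous_on_excess excess_antimono excess_mono\<close>)
  \<comment> \<open>The rate \<open>1 / 32 ^ j\<close> beats the weights \<open>64 * 16 ^ j\<close>
    in \<open>E\<close> below; the remaining terms \<open>64 * (1/2) ^ j\<close> sum to at most
    128.\<close>
  then have "\<exists>N. \<forall>A. finite A \<longrightarrow> L (excess y N A) \<le> 1 / 32 ^ j" for j :: nat by simp
  then obtain N where N: "\<And>j A. finite A \<Longrightarrow> L (excess y (N j) A) \<le> 1 / 32 ^ j" by metis
  \<comment> \<open>Partial sums make the levels increase. Starting at 1 gives
    \<open>M 0 = 0\<close>, so that level 0 contains only \<open>y 0 = 0\<close> and has the trivial
    bound 1.\<close>
  define M where "M j = (\<Sum>i=1..j. Suc (N i))" for j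
  have M0: "M 0 = 0" by (simp add: M_def)
  have MS: "M (Suc j) = M j + Suc (N (Suc j))" for j by (simp add: M_def)
  have Mmono: "M i \<le> M j" if "i \<le> j" for i j
    using that by (induction rule: dec_induct) (auto simp: MS)
  have Mge: "j \<le> M j" for j by (induction j) (auto simp: MS)
  have LM: "L (excess y (M j) A) \<le> 1 / 32 ^ j" if A: "finite A" for j A
  proof (cases j)
    case 0
    have "L (excess y (M j) A) \<le> L (\<lambda>_. 1)"
    proof (intro mono continuous_on_excess A continuous_on_const)
      fix s assume "s \<in> (dual_ball :: ('a \<Rightarrow> real) set)"
      then obtain f where f: "s = blinfun_apply f" "norm f \<le> 1" by (rule dual_ballE)
      then show "excess y (M j) A s \<le> 1" using excess_le[OF A, of 0 "M j" y f] by (simp add: y0)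
    qed
    then show ?thesis using 0 by (simp add: one)
  next
    case (Suc i)
    have "L (excess y (M j) A) \<le> L (excess y (N j) A)"
      by (intro mono continuous_on_excess A excess_antimono) (simp add: Suc MS)
    then show ?thesis using N[OF A, of j] by simp
  qed
  define lev where "lev l = (LEAST j. l \<le> M j)" for l
  have lev: "l \<le> M (lev l)" for l unfolding lev_def by (rule LeastI[of _ l]) (rule Mge)
  have lev_le: "lev l \<le> j" if "l \<le> M j" for l j unfolding lev_def using that by (rule Least_le)
  \<comment> \<open>The normalised increments of all pairs. Only finitely many pairs have both
    indices at most \<open>M j\<close>, so damping by level makes the sequence null, at the price of
    the factor \<open>2 ^ lev (max i l)\<close> in \<open>vy\<close>.\<close>
  define w where "w n = (case prod_decode n of (i, l) \<Rightarrow> (1/2) ^ lev (max i l) *\<^sub>R sgn (y l - y i))" for n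
  have w: "w (prod_encode (i, l)) = (1/2) ^ lev (max i l) *\<^sub>R sgn (y l - y i)" for i l
    by (simp add: w_def)
  have "w \<longlonglongrightarrow> 0"
  proof (rule LIMSEQ_I)
    fix r :: real assume "0 < r"
    then obtain j where j: "(1/2) ^ j < r" using real_arch_pow_inv[of r "1/2"] by auto
    have "finite (prod_encode ` ({..M j} \<times> {..M j}))" by simp
    then obtain n0 where n0: "\<And>n. n \<in> prod_encode ` ({..M j} \<times> {..M j}) \<Longrightarrow> n < n0"
      unfolding finite_nat_set_iff_bounded by blast
    have "norm (w n - 0) < r" if "n0 \<le> n" for n
    proof -
      obtain i l where il: "n = prod_encode (i, l)" by (metis prod_decode_inverse surj_pair)
      have "\<not> (i \<le> M j \<and> l \<le> M j)" using n0[of n] that il by (auto simp: image_iff)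
      then have "j \<le> lev (max i l)"
        using lev[of "max i l"] Mmono[of "lev (max i l)" j] by (metis le_trans linear max.boundedE)
      then have "(1/2 :: real) ^ lev (max i l) \<le> (1/2) ^ j" by (intro power_decreasing) auto
      moreover have "norm (w n) \<le> (1/2) ^ lev (max i l)" by (simp add: il w norm_sgn)
      ultimately have "norm (w n) < r" using j by linarith
      then show ?thesis by simp
    qed
    then show "\<exists>n0. \<forall>n\<ge>n0. norm (w n - 0) < r" by blast
  qed
  moreover have "L (\<lambda>s. \<Sum>k<n. \<bar>s (x k - u (x k))\<bar> powr p) \<le> 128 * (\<epsilon> powr p * weak_p_norm p n x powr p)"
    if \<epsilon>: "0 \<le> \<epsilon>" and we: "\<And>m. norm (w m - (w m o\<^sub>L u)) \<le> \<epsilon>" for u \<epsilon> n x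
  proof -
    define W where "W = \<epsilon> powr p * weak_p_norm p n x powr p"
    have W: "0 \<le> W" by (simp add: W_def)
    define v where "v f = f - (f o\<^sub>L u)" for f :: "'a \<Rightarrow>\<^sub>L real"
    have v_apply: "v f z = f z - f (u z)" for f z by (simp add: v_def blinfun.diff_left)
    have v_diff: "v (f - g) = v f - v g" and v_scale: "v (c *\<^sub>R f) = c *\<^sub>R v f" for f g c
      by (auto intro!: blinfun_eqI simp: v_apply blinfun.diff_left blinfun.scaleR_left right_diff_distrib)
    have vy: "norm (v (y l - y i)) \<le> \<epsilon> * 2 ^ lev (max i l) * norm (y l - y i)" for i l
    proof -
      have "(1/2) ^ lev (max i l) * norm (v (sgn (y l - y i))) \<le> \<epsilon>"
        using we[of "prod_encode (i, l)"] by (simp add: w v_scale flip: v_def)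
      then have "norm (v (sgn (y l - y i))) \<le> \<epsilon> * 2 ^ lev (max i l)" by (simp add: field_simps)
      then have "norm (v (sgn (y l - y i))) * norm (y l - y i) \<le> \<epsilon> * 2 ^ lev (max i l) * norm (y l - y i)"
        by (intro mult_right_mono) auto
      also have "norm (v (sgn (y l - y i))) * norm (y l - y i) = norm (v (norm (y l - y i) *\<^sub>R sgn (y l - y i)))"
        by (simp add: v_scale)
      finally show ?thesis by (simp add: norm_scaleR_sgn)
    qed
    \<comment> \<open>Majorants directed in \<open>J\<close> and \<open>A\<close>; with growing
      \<open>A\<close> the excess approaches the distance to
      \<open>y 0, ..., y (M j)\<close>.\<close>
    define E where "E J A s = W * (\<Sum>j\<le>J. 64 * 16 ^ j * excess y (M j) A s)" for J A and s :: "'a \<Rightarrow> real"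
    have E_le: "E J A s \<le> E J' A' s" if "J \<le> J'" "finite A'" "A \<subseteq> A'" for J J' A A' s
    proof -
      have "(\<Sum>j\<le>J. 64 * 16 ^ j * excess y (M j) A s) \<le> (\<Sum>j\<le>J. 64 * 16 ^ j * excess y (M j) A' s)"
        using that by (intro sum_mono mult_left_mono excess_mono) auto
      also have "\<dots> \<le> (\<Sum>j\<le>J'. 64 * 16 ^ j * excess y (M j) A' s)"
        using that by (intro sum_mono2) (auto intro!: mult_nonneg_nonneg excess_nonneg)
      finally show ?thesis unfolding E_def using W by (rule mult_left_mono)
    qed
    have Ec: "ball_continuous (E J A)" if "finite A" for J A
      unfolding E_def using that by (intro continuous_intros continuous_on_excess)
    let ?g = "\<lambda>s. \<Sum>k<n. \<bar>s (x k - u (x k))\<bar> powr p"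
    have "L ?g \<le> 128 * W"
    proof (rule le_of_directed[where G = "{E J A |J A. finite A}"])
      show "ball_continuous ?g" using p by (intro continuous_on_sum continuous_on_eval_powr) auto
      show "ball_continuous h" if "h \<in> {E J A |J A. finite A}" for h using that Ec by auto
      show "{E J A |J A. finite A} \<noteq> {}" by (auto intro: finite.emptyI)
    next
      fix g h assume "g \<in> {E J A |J A. finite A}" "h \<in> {E J A |J A. finite A}"
      then obtain J A J' A' where *: "g = E J A" "finite A" "h = E J' A'" "finite A'" by blast
      then have "E (max J J') (A \<union> A') \<in> {E J A |J A. finite A}" by blast
      moreover have "g s \<le> E (max J J') (A \<union> A') s \<and> h s \<le> E (max J J') (A \<union> A') s" for s
        using * by (auto intro!: E_le)
      ultimately show "\<exists>k\<in>{E J A |J A. finite A}. \<forall>s\<in>dual_ball. g s \<le> k s \<and> h s \<le> k s" by blast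
    next
      fix s e assume s: "s \<in> support" and e: "0 < (e :: real)"
      obtain f where f: "s = blinfun_apply f" "norm f \<le> 1" using s support_subset by (auto elim: dual_ballE)
      define dis where "dis j = Min ((\<lambda>i. norm (f - y i)) ` {..M j})" for j
      have "\<exists>i\<le>M j. norm (f - y i) = dis j" for j
        using Min_in[of "(\<lambda>i. norm (f - y i)) ` {..M j}"] unfolding dis_def by fastforce
      then obtain i where i: "\<And>j. i j \<le> M j" "\<And>j. norm (f - y (i j)) = dis j" by metis
      have dis_le: "dis j \<le> norm (f - y l)" if "l \<le> M j" for j l
        unfolding dis_def using that by (intro Min_le) auto
      have dis0: "0 \<le> dis j" for j using i(2)[of j] by (metis norm_ge_zero)
      have dis1: "dis j \<le> 1" for j using dis_le[of 0 j] f(2) by (simp add: y0)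
      have "dis \<longlonglongrightarrow> 0"
      proof (rule LIMSEQ_I)
        fix r :: real assume r: "0 < r"
        obtain l where l: "norm (f - y l) < r" using approx[of f r] s r f(1) by auto
        have "dis j < r" if "l \<le> j" for j
          using dis_le[of l j] l Mge[of j] that by linarith
        then show "\<exists>l. \<forall>j\<ge>l. norm (dis j - 0) < r" using dis0 by auto
      qed
      then have fy: "(\<lambda>j. f - y (i j)) \<longlonglongrightarrow> 0" by (subst tendsto_norm_zero_iff[symmetric]) (simp add: i(2))
      have yi: "(\<lambda>j. y (i j)) \<longlonglongrightarrow> f"
        using tendsto_diff[OF tendsto_const[of f] fy] by simp
      have step: "norm (v (y (i (Suc j))) - v (y (i j))) \<le> \<epsilon> * 2 ^ Suc j * (dis j + dis (Suc j))" for j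
      proof -
        have "i (Suc j) \<le> M (Suc j)" "i j \<le> M (Suc j)" using i(1)[of "Suc j"] i(1)[of j] Mmono[of j "Suc j"] by auto
        then have "lev (max (i j) (i (Suc j))) \<le> Suc j" by (intro lev_le) simp
        then have "(2::real) ^ lev (max (i j) (i (Suc j))) \<le> 2 ^ Suc j" by (intro power_increasing) auto
        moreover have "norm (y (i (Suc j)) - y (i j)) \<le> dis j + dis (Suc j)"
          using norm_triangle_ineq4[of "f - y (i j)" "f - y (i (Suc j))"] by (simp add: i(2))
        ultimately have "\<epsilon> * 2 ^ lev (max (i j) (i (Suc j))) * norm (y (i (Suc j)) - y (i j))
            \<le> \<epsilon> * 2 ^ Suc j * (dis j + dis (Suc j))"
          using \<epsilon> by (intro mult_mono mult_left_mono) auto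
        then show ?thesis using vy[of "i (Suc j)" "i j"] by (simp add: v_diff)
      qed
      \<comment> \<open>The extra term on the left is the share of \<open>dis J\<close> in the next
        increment, so the induction can pay for it in advance.\<close>
      have vJ: "norm (v (y (i J))) + \<epsilon> * 2 ^ Suc J * dis J \<le> \<epsilon> * (\<Sum>j\<le>J. 2 ^ (j + 2) * dis j)" for J
      proof (induction J)
        case 0
        have "y (i 0) = 0" using i(1)[of 0] by (simp add: M0 y0)
        then have "v (y (i 0)) = 0" using v_diff[of 0 0] by simp
        moreover have "0 \<le> \<epsilon> * dis 0" using \<epsilon> dis0 by simp
        ultimately show ?case by simp
      next
        case (Suc J)
        define q where "q = \<epsilon> * 2 ^ J * dis (Suc J)"
        have q: "0 \<le> q" using \<epsilon> dis0 by (simp add: q_def)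
        have "norm (v (y (i (Suc J)))) \<le> norm (v (y (i J))) + \<epsilon> * 2 ^ Suc J * (dis J + dis (Suc J))"
          using step[of J] norm_triangle_sub[of "v (y (i (Suc J)))" "v (y (i J))"] by linarith
        then have "norm (v (y (i (Suc J)))) \<le> (norm (v (y (i J))) + \<epsilon> * 2 ^ Suc J * dis J) + 2 * q"
          by (simp add: q_def algebra_simps)
        moreover have "\<epsilon> * (\<Sum>j\<le>Suc J. 2 ^ (j + 2) * dis j) = \<epsilon> * (\<Sum>j\<le>J. 2 ^ (j + 2) * dis j) + 8 * q"
          by (simp add: q_def algebra_simps)
        moreover have "\<epsilon> * 2 ^ Suc (Suc J) * dis (Suc J) = 4 * q" by (simp add: q_def)
        ultimately show ?case using Suc q by linarith
      qed
      have vW: "norm (v (y (i J))) powr p * weak_p_norm p n x powr p \<le> W * (\<Sum>j\<le>J. 64 * 16 ^ j * dis j)" for J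
      proof -
        have "0 \<le> \<epsilon> * 2 ^ Suc J * dis J" using \<epsilon> dis0 by simp
        then have "norm (v (y (i J))) \<le> \<epsilon> * (\<Sum>j\<le>J. 2 ^ (j + 2) * dis j)" using vJ[of J] by linarith
        then have "norm (v (y (i J))) powr p \<le> (\<epsilon> * (\<Sum>j\<le>J. 2 ^ (j + 2) * dis j)) powr p"
          using p by (intro powr_mono2) auto
        also have "\<dots> = \<epsilon> powr p * (\<Sum>j\<le>J. 2 ^ (j + 2) * dis j) powr p"
          by (simp add: powr_mult)
        also have "\<dots> \<le> \<epsilon> powr p * (\<Sum>j\<le>J. (2 ^ Suc j * (2 ^ (j + 2) * dis j)) powr p)"
          using dis0 p by (intro mult_left_mono sum_powr_le_geometric) auto
        also have "\<dots> \<le> \<epsilon> powr p * (\<Sum>j\<le>J. 64 * 16 ^ j * dis j)"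
        proof (intro mult_left_mono sum_mono)
          fix j
          have "(2 ^ Suc j * (2 ^ (j + 2) * dis j)) powr p = (8 * 4 ^ j) powr p * dis j powr p"
            by (simp add: power_add algebra_simps flip: powr_mult power_mult_distrib)
          \<comment> \<open>\<open>p \<le> 2\<close> bounds the weight; \<open>1 \<le> p\<close> and
            \<open>dis j \<le> 1\<close> bound the distance. The result is linear in the distance,
            as the integrals of \<open>excess\<close> require.\<close>
          also have "\<dots> \<le> (8 * 4 ^ j) powr 2 * dis j powr 1"
          proof (rule mult_mono)
            have "(1::real) \<le> 8 * 4 ^ j" using one_le_power[of "4::real" j] by linarith
            then show "(8 * 4 ^ j :: real) powr p \<le> (8 * 4 ^ j) powr 2" using p by (intro powr_mono) auto
            show "dis j powr p \<le> dis j powr 1" using p dis0 dis1 by (intro powr_mono') auto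
          qed auto
          also have "\<dots> = 64 * 16 ^ j * dis j"
          proof -
            have "(4 ^ j)\<^sup>2 = (16 ^ j :: real)" by (simp add: power2_eq_square flip: power_mult_distrib)
            then show ?thesis using dis0[of j] by (simp add: power_mult_distrib)
          qed
          finally show "(2 ^ Suc j * (2 ^ (j + 2) * dis j)) powr p \<le> 64 * 16 ^ j * dis j" .
        qed simp
        finally have "norm (v (y (i J))) powr p * weak_p_norm p n x powr p
            \<le> \<epsilon> powr p * (\<Sum>j\<le>J. 64 * 16 ^ j * dis j) * weak_p_norm p n x powr p"
          by (intro mult_right_mono) auto
        then show ?thesis by (simp add: W_def mult_ac)
      qed
      \<comment> \<open>\<open>J\<close> depends on the functional \<open>f\<close> and costs
        \<open>e / 2\<close>; \<open>le_of_directed\<close> permits this dependence.\<close>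
      have "(\<lambda>J. v (y (i J))) \<longlonglongrightarrow> v f"
        unfolding v_def by (intro tendsto_diff yi bounded_bilinear.tendsto[OF bounded_bilinear_blinfun_compose] tendsto_const)
      then have "(\<lambda>J. norm (v (y (i J))) powr p * weak_p_norm p n x powr p) \<longlonglongrightarrow>
          norm (v f) powr p * weak_p_norm p n x powr p"
        using p by (intro tendsto_mult tendsto_const tendsto_powr' tendsto_norm) auto
      then have "\<forall>\<^sub>F J in sequentially. norm (v f) powr p * weak_p_norm p n x powr p - e / 2
          < norm (v (y (i J))) powr p * weak_p_norm p n x powr p"
        using e by (intro order_tendstoD) auto
      then obtain J where J: "norm (v f) powr p * weak_p_norm p n x powr p - e / 2
          < norm (v (y (i J))) powr p * weak_p_norm p n x powr p"
        by (auto simp: eventually_sequentially)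
      have "?g s = (\<Sum>k<n. \<bar>v f (x k)\<bar> powr p)"
        by (simp add: f(1) v_def blinfun.diff_left blinfun.diff_right)
      also have "\<dots> \<le> norm (v f) powr p * weak_p_norm p n x powr p" by (rule sum_functional_powr_le[OF p(1)])
      finally have g: "?g s < W * (\<Sum>j\<le>J. 64 * 16 ^ j * dis j) + e / 2" using J vW[of J] by linarith
      define S where "S = (\<Sum>j\<le>J. 64 * 16 ^ j :: real)"
      \<comment> \<open>The other \<open>e / 2\<close> pays for replacing distances by
        \<open>excess\<close> over finite sets; the summand 1 keeps the denominator
        positive.\<close>
      define \<eta> where "\<eta> = e / (2 * (W * S + 1))"
      have WS: "0 \<le> W * S" unfolding S_def using W by (intro mult_nonneg_nonneg sum_nonneg) auto
      then have \<eta>: "0 < \<eta>" using e by (simp add: \<eta>_def)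
      have "W * S * \<eta> \<le> (W * S + 1) * \<eta>" using \<eta> by (intro mult_right_mono) auto
      also have "\<dots> = e / 2"
      proof -
        have "X * (e / (2 * X)) = e / 2" if "0 < X" for X :: real using that by simp
        from this[of "W * S + 1"] show ?thesis using WS unfolding \<eta>_def by linarith
      qed
      finally have WS\<eta>: "W * S * \<eta> \<le> e / 2" .
      have "\<exists>A. finite A \<and> dis j \<le> excess y (M j) A s + \<eta>" for j
        using excess_approaches[OF \<eta>, of "M j" f y] dis_le order_trans unfolding f(1) by metis
      then obtain A where A: "\<And>j. finite (A j)" "\<And>j. dis j \<le> excess y (M j) (A j) s + \<eta>" by metis
      define B where "B = (\<Union>j\<le>J. A j)"
      have B: "finite B" using A(1) by (simp add: B_def)
      have "(\<Sum>j\<le>J. 64 * 16 ^ j * dis j) \<le> (\<Sum>j\<le>J. 64 * 16 ^ j * (excess y (M j) B s + \<eta>))"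
      proof (intro sum_mono mult_left_mono)
        fix j assume "j \<in> {..J}"
        then have "excess y (M j) (A j) s \<le> excess y (M j) B s" by (intro excess_mono B) (auto simp: B_def)
        then show "dis j \<le> excess y (M j) B s + \<eta>" using A(2)[of j] by linarith
      qed simp
      also have "\<dots> = (\<Sum>j\<le>J. 64 * 16 ^ j * excess y (M j) B s) + S * \<eta>"
        by (simp add: S_def distrib_left sum.distrib sum_distrib_right)
      finally have "W * (\<Sum>j\<le>J. 64 * 16 ^ j * dis j) \<le> W * ((\<Sum>j\<le>J. 64 * 16 ^ j * excess y (M j) B s) + S * \<eta>)"
        using W by (rule mult_left_mono)
      also have "\<dots> = E J B s + W * S * \<eta>" by (simp add: E_def distrib_left)
      finally have "?g s < E J B s + e" using g WS\<eta> by linarith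
      then show "\<exists>h\<in>{E J A |J A. finite A}. ?g s < h s + e" using B by blast
    next
      fix h assume "h \<in> {E J A |J A. finite A}"
      then obtain J A where h: "h = E J A" "finite A" by blast
      have "L (E J A) = W * L (\<lambda>s. \<Sum>j\<le>J. 64 * 16 ^ j * excess y (M j) A s)"
        unfolding E_def using h by (intro scale continuous_intros continuous_on_excess)
      also have "L (\<lambda>s. \<Sum>j\<le>J. 64 * 16 ^ j * excess y (M j) A s) = (\<Sum>j\<le>J. L (\<lambda>s. (64 * 16 ^ j) * excess y (M j) A s))"
        using h by (intro sum continuous_intros continuous_on_excess)
      also have "\<dots> = (\<Sum>j\<le>J. 64 * 16 ^ j * L (excess y (M j) A))"
        using h by (intro sum.cong refl scale continuous_on_excess)
      also have "\<dots> \<le> (\<Sum>j\<le>J. 64 * (1/2) ^ j)"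
      proof (rule sum_mono)
        fix j
        have "64 * 16 ^ j * L (excess y (M j) A) \<le> 64 * 16 ^ j * (1 / 32 ^ j)"
          by (intro mult_left_mono LM h) auto
        also have "\<dots> = 64 * (1/2) ^ j" using power_divide[of "16::real" 32 j] by simp
        finally show "64 * 16 ^ j * L (excess y (M j) A) \<le> 64 * (1/2) ^ j" .
      qed
      also have "\<dots> = 128 - 64 * (1/2) ^ J" by (induction J) auto
      also have "\<dots> \<le> 128" by simp
      finally show "L h \<le> 128 * W" using W by (simp add: h mult.commute mult_right_mono)
    qed
    then show ?thesis by (simp add: W_def)
  qed
  ultimately show ?thesis by blast
qed

end

text \<open>For a rank one operator the functional is absorbed in the weak norm, and
  \<open>norm (\<theta> n y) powr p\<close> tends to 0. The factor \<open>2 powr p\<close> of each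
  addition is harmless because the summands of \<open>u\<close> do not depend on
  \<open>n\<close>.\<close>

lemma rank_one_sums_tend_to_zero:
  fixes \<theta> :: "nat \<Rightarrow> 'a::real_normed_vector \<Rightarrow>\<^sub>L 'b::real_normed_vector"
  assumes p: "1 \<le> p" and \<theta>: "\<And>x. (\<lambda>n. norm (\<theta> n x)) \<longlonglongrightarrow> 0"
    and u: "(u :: 'a \<Rightarrow>\<^sub>L 'a) \<in> span rank_ones"
  shows "\<exists>\<delta>. \<delta> \<longlonglongrightarrow> 0 \<and> (\<forall>n N x. (\<Sum>k<N. norm (\<theta> n (u (x k))) powr p) \<le> \<delta> n * weak_p_norm p N x powr p)"
  using u
proof (induction rule: span_induct_alt)
  case base
  show ?case by (intro exI[of _ "\<lambda>_. 0"]) simp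
next
  case (step c r v)
  obtain f y where r: "r = rank_one f y" using step(1) by (auto simp: rank_ones_def)
  obtain \<delta> where \<delta>: "\<delta> \<longlonglongrightarrow> 0"
    "\<And>n N x. (\<Sum>k<N. norm (\<theta> n (v (x k))) powr p) \<le> \<delta> n * weak_p_norm p N x powr p"
    using step(2) by blast
  define \<gamma> where "\<gamma> n = norm (\<theta> n y) powr p" for n
  have \<gamma>: "\<gamma> \<longlonglongrightarrow> 0"
    using tendsto_powr'[OF \<theta>[of y] tendsto_const[of p]] p unfolding \<gamma>_def by simp
  define \<eta> where "\<eta> n = 2 powr p * (norm (c *\<^sub>R f) powr p * \<gamma> n + \<delta> n)" for n
  have "\<eta> \<longlonglongrightarrow> 2 powr p * (norm (c *\<^sub>R f) powr p * 0 + 0)"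
    unfolding \<eta>_def by (intro tendsto_intros \<gamma> \<delta>)
  moreover have "(\<Sum>k<N. norm (\<theta> n ((c *\<^sub>R r + v) (x k))) powr p) \<le> \<eta> n * weak_p_norm p N x powr p" for n N x
  proof -
    have "norm (\<theta> n ((c *\<^sub>R r + v) (x k))) powr p
        \<le> 2 powr p * (\<gamma> n * \<bar>(c *\<^sub>R f) (x k)\<bar> powr p + norm (\<theta> n (v (x k))) powr p)" for k
    proof -
      have "\<theta> n ((c *\<^sub>R r + v) (x k)) = (c *\<^sub>R f) (x k) *\<^sub>R \<theta> n y + \<theta> n (v (x k))"
        by (simp add: r blinfun.add_left blinfun.scaleR_left blinfun.add_right blinfun.scaleR_right)
      then have "norm (\<theta> n ((c *\<^sub>R r + v) (x k))) \<le> \<bar>(c *\<^sub>R f) (x k)\<bar> * norm (\<theta> n y) + norm (\<theta> n (v (x k)))"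
        using norm_triangle_ineq[of "(c *\<^sub>R f) (x k) *\<^sub>R \<theta> n y" "\<theta> n (v (x k))"] by simp
      then have "norm (\<theta> n ((c *\<^sub>R r + v) (x k))) powr p
          \<le> (\<bar>(c *\<^sub>R f) (x k)\<bar> * norm (\<theta> n y) + norm (\<theta> n (v (x k)))) powr p"
        using p by (intro powr_mono2) auto
      also have "\<dots> \<le> 2 powr p * ((\<bar>(c *\<^sub>R f) (x k)\<bar> * norm (\<theta> n y)) powr p + norm (\<theta> n (v (x k))) powr p)"
        using p by (intro powr_add_le) auto
      finally show ?thesis by (simp add: powr_mult \<gamma>_def mult.commute)
    qed
    then have "(\<Sum>k<N. norm (\<theta> n ((c *\<^sub>R r + v) (x k))) powr p)
        \<le> (\<Sum>k<N. 2 powr p * (\<gamma> n * \<bar>(c *\<^sub>R f) (x k)\<bar> powr p + norm (\<theta> n (v (x k))) powr p))"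
      by (rule sum_mono)
    also have "\<dots> = 2 powr p * (\<gamma> n * (\<Sum>k<N. \<bar>(c *\<^sub>R f) (x k)\<bar> powr p) + (\<Sum>k<N. norm (\<theta> n (v (x k))) powr p))"
      by (simp add: sum.distrib sum_distrib_left distrib_left mult.assoc)
    also have "\<dots> \<le> 2 powr p * (\<gamma> n * (norm (c *\<^sub>R f) powr p * weak_p_norm p N x powr p)
        + \<delta> n * weak_p_norm p N x powr p)"
      by (intro mult_left_mono add_mono sum_functional_powr_le p \<delta>(2)) (auto simp: \<gamma>_def)
    also have "\<dots> = \<eta> n * weak_p_norm p N x powr p" by (simp add: \<eta>_def algebra_simps)
    finally show ?thesis .
  qed
  ultimately show ?case by (intro exI[of _ \<eta>]) simp
qed

text \<open>The estimate says that \<open>e powr (1 / p)\<close> is a summing constant of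
  \<open>\<psi> - (\<psi> o\<^sub>L u)\<close>. It is kept in p-th powers, in which the
  contributions are later added.\<close>

lemma p_summing_approximable:
  fixes \<psi> :: "'e::real_normed_vector \<Rightarrow>\<^sub>L 'f::real_normed_vector"
  assumes p: "1 \<le> p" "p \<le> 2"
    and E: "reflexive_space TYPE('e) \<or> separable_space (euclidean :: ('e \<Rightarrow>\<^sub>L real) topology)"
    and ap: "approximation_property TYPE(('e \<Rightarrow>\<^sub>L real) \<Rightarrow>\<^sub>L real)"
    and \<psi>: "p_summing p \<psi>" and e: "0 < e"
  obtains u :: "'e \<Rightarrow>\<^sub>L 'e" where "u \<in> span rank_ones"
    "\<And>n x. (\<Sum>k<n. norm (\<psi> (x k - u (x k))) powr p) \<le> e * weak_p_norm p n x powr p"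
proof -
  obtain c where c: "c \<in> summing_constants p \<psi>" using \<psi> by (auto simp: p_summing_def)
  obtain L where L: "positive_functional dual_ball L"
    and dom: "\<And>x. norm (\<psi> x) powr p \<le> c powr p * L (\<lambda>s. \<bar>s x\<bar> powr p)"
    using pietsch_domination[OF p(1) c] by metis
  interpret dual_functional L by (rule dual_functional.intro[OF L])
  obtain D :: "('e \<Rightarrow>\<^sub>L real) set"
    where D: "countable D" "\<And>f. blinfun_apply f \<in> support \<Longrightarrow> f \<in> closure D"
  proof (cases "reflexive_space TYPE('e)")
    case True
    then show ?thesis using support_separable_reflexive that by metis
  next
    case False
    then obtain D :: "('e \<Rightarrow>\<^sub>L real) set" where "countable D" "closure D = UNIV"
      using E by (auto simp: separable_space_def)
    then show ?thesis using that by auto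
  qed
  obtain w :: "nat \<Rightarrow> 'e \<Rightarrow>\<^sub>L real" where w: "w \<longlonglongrightarrow> 0"
    and ctrl: "\<And>u \<epsilon> n x. 0 \<le> \<epsilon> \<Longrightarrow> (\<And>m. norm (w m - (w m o\<^sub>L u)) \<le> \<epsilon>) \<Longrightarrow>
      L (\<lambda>s. \<Sum>k<n. \<bar>s (x k - u (x k))\<bar> powr p) \<le> 128 * (\<epsilon> powr p * weak_p_norm p n x powr p)"
    using ex_controlling_null_sequence[OF D p] by blast
  define C where "C = 128 * c powr p"
  have C: "0 \<le> C" by (simp add: C_def)
  \<comment> \<open>Chosen so that \<open>C * \<epsilon> powr p \<le> e\<close>; the summand 1
    covers \<open>C = 0\<close>.\<close>
  define \<epsilon> where "\<epsilon> = (e / (C + 1)) powr (1 / p)"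
  have \<epsilon>: "0 < \<epsilon>" "\<epsilon> powr p = e / (C + 1)" using e p C by (auto simp: \<epsilon>_def powr_powr)
  obtain u where u: "u \<in> span rank_ones" "\<And>m. norm (w m - (w m o\<^sub>L u)) \<le> \<epsilon>"
    using bidual_ap_approximates_adjointly[OF ap w \<epsilon>(1)] by metis
  show thesis
  proof
    show "u \<in> span rank_ones" by fact
    fix n and x :: "nat \<Rightarrow> 'e"
    have "(\<Sum>k<n. norm (\<psi> (x k - u (x k))) powr p) \<le> (\<Sum>k<n. c powr p * L (\<lambda>s. \<bar>s (x k - u (x k))\<bar> powr p))"
      by (intro sum_mono dom)
    also have "\<dots> = c powr p * L (\<lambda>s. \<Sum>k<n. \<bar>s (x k - u (x k))\<bar> powr p)"
      using p by (subst sum) (auto simp: sum_distrib_left intro: continuous_on_eval_powr)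
    also have "\<dots> \<le> c powr p * (128 * (\<epsilon> powr p * weak_p_norm p n x powr p))"
      using \<epsilon>(1) by (intro mult_left_mono ctrl u) auto
    also have "\<dots> = C * (e / (C + 1)) * weak_p_norm p n x powr p" by (simp add: C_def \<epsilon>(2))
    also have "\<dots> \<le> e * weak_p_norm p n x powr p"
      using C e by (intro mult_right_mono) (auto simp: field_simps)
    finally show "(\<Sum>k<n. norm (\<psi> (x k - u (x k))) powr p) \<le> e * weak_p_norm p n x powr p" .
  qed
qed

theorem theorem3:
  fixes p :: real
    and \<psi> :: "'e::banach \<Rightarrow>\<^sub>L 'f::banach"
    and \<phi> :: "nat \<Rightarrow> 'f \<Rightarrow>\<^sub>L 'f"
  assumes "1 \<le> p" and "p \<le> 2"
    and "reflexive_space TYPE('e) \<or> separable_space (euclidean :: ('e \<Rightarrow>\<^sub>L real) topology)"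
    and "approximation_property TYPE(('e \<Rightarrow>\<^sub>L real) \<Rightarrow>\<^sub>L real)"
    and "separable_space (euclidean :: ('f \<Rightarrow>\<^sub>L real) topology)"
    and "p_summing p \<psi>"
    and "\<And>y. (\<lambda>n. norm (\<phi> n y)) \<longlonglongrightarrow> 0"
  shows "(\<lambda>n. pi_p p (\<phi> n o\<^sub>L \<psi>)) \<longlonglongrightarrow> 0"
proof (rule LIMSEQ_I)
  note p = assms(1,2)
  fix e0 :: real assume e0: "0 < e0"
  \<comment> \<open>Membership of \<open>e\<close> in the summing constants yields only
    \<open>\<le>\<close>, hence the margin below \<open>e0\<close>.\<close>
  define e where "e = e0 / 2"
  have e: "0 < e" "e < e0" using e0 by (auto simp: e_def)
  have "Bseq (\<lambda>n. \<phi> n y)" for y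
    using assms(7)[of y] by (metis convergent_imp_Bseq convergentI tendsto_norm_zero_iff)
  then obtain B where B: "0 < B" "\<And>n. norm (\<phi> n) \<le> B"
    using banach_steinhaus[of \<phi>] by (auto simp: Bseq_def)
  \<comment> \<open>\<open>K\<close> collects the factor from splitting a p-th power and the uniform
    bound of the \<open>\<phi> n\<close>. The remainder and the finite rank part are each allowed
    half of \<open>e powr p\<close>.\<close>
  define K where "K = 2 powr p * B powr p"
  have K: "0 < K" using B by (simp add: K_def)
  obtain u :: "'e \<Rightarrow>\<^sub>L 'e" where u: "u \<in> span rank_ones"
    "\<And>n x. (\<Sum>k<n. norm (\<psi> (x k - u (x k))) powr p) \<le> (e powr p / (2 * K)) * weak_p_norm p n x powr p"
    using p_summing_approximable[OF p assms(3,4,6), of "e powr p / (2 * K)"] e K by auto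
  obtain \<delta> where \<delta>: "\<delta> \<longlonglongrightarrow> 0"
    "\<And>n N x. (\<Sum>k<N. norm ((\<phi> n o\<^sub>L \<psi>) (u (x k))) powr p) \<le> \<delta> n * weak_p_norm p N x powr p"
    using rank_one_sums_tend_to_zero[OF p(1) _ u(1), of "\<lambda>n. \<phi> n o\<^sub>L \<psi>"] assms(7) by auto
  have "\<forall>\<^sub>F n in sequentially. \<delta> n < e powr p / (2 * 2 powr p)"
    using e by (intro order_tendstoD[OF \<delta>(1)]) auto
  then obtain n0 where n0: "\<And>n. n0 \<le> n \<Longrightarrow> \<delta> n < e powr p / (2 * 2 powr p)"
    by (auto simp: eventually_sequentially)
  have "norm (pi_p p (\<phi> n o\<^sub>L \<psi>) - 0) < e0" if n: "n0 \<le> n" for n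
  proof -
    have "(\<Sum>k<N. norm ((\<phi> n o\<^sub>L \<psi>) (x k)) powr p) powr (1 / p) \<le> e * weak_p_norm p N x" for N x
    proof -
      define W where "W = weak_p_norm p N x powr p"
      have W: "0 \<le> W" by (simp add: W_def)
      have "norm ((\<phi> n o\<^sub>L \<psi>) (x k)) powr p \<le> K * norm (\<psi> (x k - u (x k))) powr p
          + 2 powr p * norm ((\<phi> n o\<^sub>L \<psi>) (u (x k))) powr p" for k
      proof -
        have "norm (\<phi> n (\<psi> (x k - u (x k)))) \<le> B * norm (\<psi> (x k - u (x k)))"
          using norm_blinfun[of "\<phi> n" "\<psi> (x k - u (x k))"] mult_right_mono[OF B(2)[of n], of "norm (\<psi> (x k - u (x k)))"]
          by simp
        moreover have "norm ((\<phi> n o\<^sub>L \<psi>) (x k)) = norm (\<phi> n (\<psi> (x k - u (x k))) + (\<phi> n o\<^sub>L \<psi>) (u (x k)))"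
          by (simp add: blinfun.diff_right)
        ultimately have "norm ((\<phi> n o\<^sub>L \<psi>) (x k)) \<le> B * norm (\<psi> (x k - u (x k))) + norm ((\<phi> n o\<^sub>L \<psi>) (u (x k)))"
          using norm_triangle_ineq[of "\<phi> n (\<psi> (x k - u (x k)))" "(\<phi> n o\<^sub>L \<psi>) (u (x k))"] by linarith
        then have "norm ((\<phi> n o\<^sub>L \<psi>) (x k)) powr p
            \<le> (B * norm (\<psi> (x k - u (x k))) + norm ((\<phi> n o\<^sub>L \<psi>) (u (x k)))) powr p"
          using p by (intro powr_mono2) auto
        also have "\<dots> \<le> 2 powr p * ((B * norm (\<psi> (x k - u (x k)))) powr p + norm ((\<phi> n o\<^sub>L \<psi>) (u (x k))) powr p)"
          using B p by (intro powr_add_le) auto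
        finally show ?thesis using B by (simp add: K_def powr_mult distrib_left mult.assoc)
      qed
      then have "(\<Sum>k<N. norm ((\<phi> n o\<^sub>L \<psi>) (x k)) powr p)
          \<le> (\<Sum>k<N. K * norm (\<psi> (x k - u (x k))) powr p + 2 powr p * norm ((\<phi> n o\<^sub>L \<psi>) (u (x k))) powr p)"
        by (rule sum_mono)
      also have "\<dots> = K * (\<Sum>k<N. norm (\<psi> (x k - u (x k))) powr p)
          + 2 powr p * (\<Sum>k<N. norm ((\<phi> n o\<^sub>L \<psi>) (u (x k))) powr p)"
        by (simp only: sum.distrib sum_distrib_left)
      also have "\<dots> \<le> K * (e powr p / (2 * K) * W) + 2 powr p * (\<delta> n * W)"
        unfolding W_def using K by (intro add_mono mult_left_mono u \<delta>) auto
      also have "\<dots> \<le> K * (e powr p / (2 * K) * W) + 2 powr p * (e powr p / (2 * 2 powr p) * W)"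
        using n0[OF n] W by (intro add_left_mono mult_left_mono mult_right_mono) auto
      also have "\<dots> = e powr p * W" using K by (simp add: field_simps)
      finally have "(\<Sum>k<N. norm ((\<phi> n o\<^sub>L \<psi>) (x k)) powr p) powr (1 / p) \<le> (e powr p * W) powr (1 / p)"
        using p by (intro powr_mono2) (auto intro: sum_nonneg)
      also have "\<dots> = e * weak_p_norm p N x"
        using e p weak_p_norm_nonneg[OF p(1), of N x] by (simp add: W_def powr_mult powr_powr)
      finally show ?thesis .
    qed
    then have mem: "e \<in> summing_constants p (\<phi> n o\<^sub>L \<psi>)" using e by (simp add: summing_constants_def)
    have "0 \<le> pi_p p (\<phi> n o\<^sub>L \<psi>)"
      using pi_p_mem[OF p(1) p_summing_compose[OF p(1) assms(6)], of "\<phi> n"]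
      by (simp add: summing_constants_def)
    then show ?thesis using pi_p_le[OF mem] e by simp
  qed
  then show "\<exists>n0. \<forall>n\<ge>n0. norm (pi_p p (\<phi> n o\<^sub>L \<psi>) - 0) < e0" by blast
qed

end
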